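(* Let $n \ge 119$ be an integer and let $r = (n+7) \bmod 18$. Then $$ar_{\mathcal{P}}(n, C_5) \ge \frac{39n - 123 - 21r}{18}.$$
   Context: All graphs are finite and simple. $C_k$ is the cycle on $k$ vertices. For positive integers $a,b$, $a \bmod b$ is the remainder when $a$ is divided by $b$. A plane triangulation is a plane graph in which every face (including the outer face) is bounded by a triangle. For a planar graph $H$ and $n \ge |H|$ (where $|H|$ is the number of vertices of $H$), $\mathcal{T}_n(H)$ is the family of all plane triangulations on $n$ vertices that contain a (not necessarily induced) subgraph isomorphic to $H$. Edge-colorings are arbitrary (not necessarily proper). A subgraph of an edge-colored graph is rainbow if all its edges have different colors. The planar anti-Ramsey number $ar_{\mathcal{P}}(n,H)$ is the maximum number of colors used in an edge-coloring of a plane triangulation $T \in \mathcal{T}_n(H)$ such that $T$ contains no rainbow copy of $H$ (the maximum is over all $T\in\mathcal{T}_n(H)$ and all such colorings of $T$). *)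

theory Defs
  imports "HOL-Analysis.Analysis"
begin

record 'a ugraph =
  verts :: "'a set"
  edges :: "'a set set"

definition simple_graph :: "'a ugraph \<Rightarrow> bool" where
  "simple_graph G \<longleftrightarrow> finite (verts G) \<and> (\<forall>e\<in>edges G. e \<subseteq> verts G \<and> card e = 2)"

definition subgraph :: "'a ugraph \<Rightarrow> 'a ugraph \<Rightarrow> bool" where
  "subgraph K G \<longleftrightarrow>
     simple_graph K \<and> simple_graph G \<and> verts K \<subseteq> verts G \<and> edges K \<subseteq> edges G"

definition isomorphic_graphs :: "'a ugraph \<Rightarrow> 'b ugraph \<Rightarrow> bool" where
  "isomorphic_graphs G H \<longleftrightarrow>
     (\<exists>f. bij_betw f (verts G) (verts H) \<and> edges H = (`) f ` edges G)"

definition copies :: "'b ugraph \<Rightarrow> 'a ugraph \<Rightarrow> 'a ugraph set" where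
  "copies H G = {K. subgraph K G \<and> isomorphic_graphs H K}"

text \<open>Intended for \<open>k \<ge> 3\<close>.\<close>

definition cycle_graph :: "nat \<Rightarrow> nat ugraph" where
  "cycle_graph k = \<lparr>verts = {..<k}, edges = (\<lambda>i. {i, Suc i mod k}) ` {..<k}\<rparr>"

text \<open>
  A plane graph is a simple graph \<open>G\<close> whose vertices are points of the plane (the type
  \<^typ>\<open>complex\<close>), together with a map \<open>d\<close> that sends each edge \<open>{u, v}\<close> to the point set
  of an arc from \<open>u\<close> to \<open>v\<close> (both endpoints included). An arc meets the vertex set only in
  its endpoints, and two different arcs meet only in common endpoints. The values of \<open>d\<close>
  outside \<open>edges G\<close> are irrelevant.
\<close>

definition plane_graph :: "complex ugraph \<Rightarrow> (complex set \<Rightarrow> complex set) \<Rightarrow> bool" where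
  "plane_graph G d \<longleftrightarrow> simple_graph G \<and>
     (\<forall>u v. {u, v} \<in> edges G \<longrightarrow>
        (\<exists>g. arc g \<and> pathstart g = u \<and> pathfinish g = v \<and> path_image g = d {u, v})) \<and>
     (\<forall>e\<in>edges G. d e \<inter> verts G = e) \<and>
     (\<forall>e\<in>edges G. \<forall>e'\<in>edges G. e \<noteq> e' \<longrightarrow> d e \<inter> d e' \<subseteq> e \<inter> e')"

definition plane_faces :: "complex ugraph \<Rightarrow> (complex set \<Rightarrow> complex set) \<Rightarrow> complex set set" where
  "plane_faces G d = components (- (verts G \<union> (\<Union>e\<in>edges G. d e)))"

text \<open>
  The three vertices \<open>x\<close>, \<open>y\<close>, \<open>z\<close> below are distinct because the edges of a simple graph
  have two elements. The unbounded component is among the faces.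
\<close>

definition plane_triangulation ::
    "complex ugraph \<Rightarrow> (complex set \<Rightarrow> complex set) \<Rightarrow> bool" where
  "plane_triangulation G d \<longleftrightarrow> plane_graph G d \<and>
     (\<forall>F\<in>plane_faces G d. \<exists>x y z. {x, y} \<in> edges G \<and> {y, z} \<in> edges G \<and> {x, z} \<in> edges G \<and>
        frontier F = d {x, y} \<union> d {y, z} \<union> d {x, z})"

definition triangulations_containing ::
    "nat \<Rightarrow> 'b ugraph \<Rightarrow> (complex ugraph \<times> (complex set \<Rightarrow> complex set)) set" where
  "triangulations_containing n H =
     {(G, d). plane_triangulation G d \<and> card (verts G) = n \<and> copies H G \<noteq> {}}"

definition rainbow :: "('a set \<Rightarrow> nat) \<Rightarrow> 'a ugraph \<Rightarrow> bool" where
  "rainbow c K \<longleftrightarrow> inj_on c (edges K)"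

definition rainbow_free_color_counts :: "nat \<Rightarrow> 'b ugraph \<Rightarrow> nat set" where
  "rainbow_free_color_counts n H =
     {card (c ` edges T) | T d c.
        (T, d) \<in> triangulations_containing n H \<and> (\<forall>K\<in>copies H T. \<not> rainbow c K)}"

definition planar_anti_ramsey :: "nat \<Rightarrow> 'b ugraph \<Rightarrow> nat" where
  "planar_anti_ramsey n H = Max (rainbow_free_color_counts n H)"

text \<open>\<^const>\<open>Max\<close> is only meaningful on finite sets.\<close>

lemma finite_rainbow_free_color_counts: "finite (rainbow_free_color_counts n H)"
proof (rule finite_subset)
  show "rainbow_free_color_counts n H \<subseteq> {..2 ^ n}"
  proof
    fix m assume "m \<in> rainbow_free_color_counts n H"
    then obtain T :: "complex ugraph" and d and c :: "complex set \<Rightarrow> nat" where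
      m: "m = card (c ` edges T)" and "(T, d) \<in> triangulations_containing n H"
      unfolding rainbow_free_color_counts_def by blast
    then have T: "plane_triangulation T d" "card (verts T) = n"
      by (auto simp: triangulations_containing_def)
    have sub: "edges T \<subseteq> Pow (verts T)" and fin: "finite (verts T)"
      using T(1) by (auto simp: plane_triangulation_def plane_graph_def simple_graph_def)
    have "card (edges T) \<le> 2 ^ n"
      using card_mono[OF _ sub] fin T(2) by (simp add: card_Pow)
    moreover have "m \<le> card (edges T)"
      unfolding m using sub fin by (intro card_image_le) (auto intro: finite_subset)
    ultimately show "m \<in> {..2 ^ n}" by simp
  qed
qed simp

end

theory Submission
  imports Defs "HOL-Complex_Analysis.Winding_Numbers"
begin

text \<open>Let \<open>W\<close> be a set of vertices of a triangulation that induces a graph without a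
  5-cycle. Colour the
  edges inside \<open>W\<close> with distinct colours, rank the remaining vertices, and colour every
    other edge with
  the smallest rank of its ends outside \<open>W\<close>. A cycle that leaves \<open>W\<close> has two
    edges of the same colour at
  its vertex of smallest rank, so there is no rainbow 5-cycle. The number of colours is the number of
  edges inside \<open>W\<close> plus the number of vertices outside \<open>W\<close>.

  To make this large, \<open>W\<close> is the vertex set of many copies of the complete graph on four
    vertices,
  arranged like the vertices of a hexagonal tube, where adjacent copies share a vertex. Cyclic
  chains of copies have length at least six. Every hexagon of the tube, and each of its two ends, is
  filled with one vertex outside \<open>W\<close>. Prolonging the tube by one hexagon costs six vertices
    and yields
  thirteen colours, and any further vertex, put into some face, yields one colour.

  The triangulations are drawn with straight edges. It suffices to give a combinatorial triangulation
  all of whose triangles but the outer one are counterclockwise; a winding number argument shows that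
  they do not overlap. The tube grows inside a small neighbourhood of the vertex at its open end.\<close>

text \<open>The constants come from two rates. A prolongation yields thirteen colours for six
  vertices, the rate \<open>39/18\<close>, but a vertex put into a face yields only one; hence
  \<open>r\<close> left-over vertices lose \<open>21 r / 18 = (39/18) r - r\<close>. A ring of
  \<open>m\<close> copies with its two hubs has \<open>3 m + 2\<close> vertices and
  \<open>6 m + 2\<close> colours. Seven copies give 23 vertices, which is congruent to
  \<open>18 k - 7\<close> modulo 6, so \<open>n = 18 k - 7 + r\<close> is reached by
  \<open>3 k - 5\<close> prolongations and \<open>r\<close> single vertices. A ring of six would
  start at 20 and miss that residue class.

  The obstacle is the geometry: faces are connected components of an open set, and a tube of
  unbounded length has no fixed table of coordinates. So the drawing changes only by inserting a
  vertex into a face and by exchanging a diagonal. The geometric preconditions of both are strict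
  orientation inequalities, which leave room for a further vertex after every step. The 5-cycles are
  controlled just as locally: three distance bounds between the free corners at the open end
  suffice, and each prolongation reproduces them for the new corners.\<close>

section \<open>Triangles in the plane\<close>

text \<open>Twice the signed area of the triangle \<open>a b c\<close>: the cross product of
  \<open>b - a\<close> and \<open>c - a\<close>.\<close>

definition crs :: "complex \<Rightarrow> complex \<Rightarrow> complex \<Rightarrow> real" where
  "crs a b c = Im (cnj (b - a) * (c - a))"

abbreviation ccw :: "complex \<Rightarrow> complex \<Rightarrow> complex \<Rightarrow> bool" where
  "ccw a b c \<equiv> 0 < crs a b c"

lemma crs_expand:
  "crs a b c = (Re b - Re a) * (Im c - Im a) - (Im b - Im a) * (Re c - Re a)"
  by (simp add: crs_def algebra_simps)

lemma crs_rotate: "crs b c a = crs a b c"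
  by (simp add: crs_expand algebra_simps)

lemma crs_swap: "crs b a c = - crs a b c"
  by (simp add: crs_expand algebra_simps)

lemma crs_self [simp]: "crs a a c = 0" "crs a b b = 0" "crs a b a = 0"
  by (simp_all add: crs_expand)

lemma ccw_distinct: "ccw a b c \<Longrightarrow> a \<noteq> b \<and> b \<noteq> c \<and> a \<noteq> c"
  by auto

lemma continuous_on_crs [continuous_intros]:
  assumes "continuous_on A f" "continuous_on A g" "continuous_on A h"
  shows "continuous_on A (\<lambda>x. crs (f x) (g x) (h x))"
  unfolding crs_def using assms by (intro continuous_intros)

definition open_triangle :: "complex \<times> complex \<times> complex \<Rightarrow> complex set" where
  "open_triangle = (\<lambda>(a, b, c). {z. ccw a b z \<and> ccw b c z \<and> ccw c a z})"

lemma open_triangle_iff: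
  "z \<in> open_triangle (a, b, c) \<longleftrightarrow> ccw a b z \<and> ccw b c z \<and> ccw c a z"
  by (simp add: open_triangle_def)

text \<open>The areas of the three triangles that \<open>z\<close> spans with the sides are its
  barycentric coordinates before normalisation.\<close>

lemma crs_barycentric:
  "crs a b z + crs b c z + crs c a z = crs a b c"
  "of_real (crs a b c) * z = of_real (crs b c z) * a + of_real (crs c a z) * b + of_real (crs a b z) * c"
  by (simp_all add: crs_expand complex_eq_iff) (simp_all add: algebra_simps)

lemma crs_affine:
  assumes "u + v + w = (1::real)"
  shows "crs p q (u *\<^sub>R a + v *\<^sub>R b + w *\<^sub>R c) = u * crs p q a + v * crs p q b + w *
    crs p q c"
proof -
  have u: "u = 1 - v - w" using assms by simp
  show ?thesis unfolding u by (simp add: crs_expand algebra_simps)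
qed

lemma mem_triangle_iff:
  assumes "ccw a b c"
  shows "z \<in> convex hull {a, b, c} \<longleftrightarrow> 0 \<le> crs a b z
    \<and> 0 \<le> crs b c z \<and> 0 \<le> crs c a z"
proof
  assume "z \<in> convex hull {a, b, c}"
  then obtain u v w where z: "z = u *\<^sub>R a + v *\<^sub>R b + w *\<^sub>R c"
      "0 \<le> u" "0 \<le> v" "0 \<le> w" "u + v + w = 1"
    unfolding convex_hull_3 by blast
  have "crs b c a = crs a b c" "crs c a b = crs a b c"
    by (simp_all add: crs_rotate)
  with z assms show "0 \<le> crs a b z \<and> 0 \<le> crs b c z \<and> 0 \<le> crs c a z"
    by (simp add: crs_affine)
next
  assume *: "0 \<le> crs a b z \<and> 0 \<le> crs b c z \<and> 0 \<le> crs c a z"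
  let ?d = "crs a b c"
  have "z = (crs b c z / ?d) *\<^sub>R a + (crs c a z / ?d) *\<^sub>R b + (crs a b z / ?d) *\<^sub>R c"
    using crs_barycentric(2)[of a b c z] assms
    by (simp add: scaleR_conv_of_real field_simps)
  moreover have "crs b c z / ?d + crs c a z / ?d + crs a b z / ?d = 1"
    using crs_barycentric(1)[of a b z c] assms by (simp add: field_simps)
  ultimately show "z \<in> convex hull {a, b, c}"
    unfolding convex_hull_3 using * assms
    by (smt (verit) divide_nonneg_pos mem_Collect_eq)
qed

lemma open_open_triangle: "open (open_triangle f)"
proof (cases f)
  case (fields a b c)
  have "open_triangle f = {z. ccw a b z} \<inter> {z. ccw b c z} \<inter> {z. ccw c a z}"
    by (auto simp: fields open_triangle_def)
  moreover have "open {z. ccw x y z}" for x y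
    by (intro open_Collect_less continuous_intros)
  ultimately show ?thesis by (simp add: open_Int)
qed

text \<open>A small move along the normal of \<open>b - a\<close> strictly increases
  \<open>crs a b\<close>, so a point on the line can be pushed off it inside
  \<open>U\<close>.\<close>

lemma crs_nonzero_near:
  assumes "a \<noteq> b" "open U" "U \<noteq> {}"
  shows "\<exists>z\<in>U. crs a b z \<noteq> 0"
proof -
  obtain z0 where z0: "z0 \<in> U" using assms by auto
  obtain e where e: "e > 0" "ball z0 e \<subseteq> U" using assms z0 openE by blast
  define t where "t = e / (2 * norm (b - a))"
  have t: "t > 0" using e assms by (simp add: t_def)
  let ?z = "z0 + of_real t * (\<i> * (b - a))"
  have "dist z0 ?z = t * norm (b - a)" using t by (simp add: dist_norm norm_mult)
  also have "\<dots> = e / 2" using assms by (simp add: t_def)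
  finally have "?z \<in> U" using e by auto
  moreover have "crs a b ?z = crs a b z0 + t * ((Re b - Re a)\<^sup>2 + (Im b - Im a)\<^sup>2)"
    by (simp add: crs_expand power2_eq_square algebra_simps)
  moreover have "(Re b - Re a)\<^sup>2 + (Im b - Im a)\<^sup>2 \<noteq> 0"
    using assms(1) by (auto simp: complex_eq_iff sum_power2_eq_zero_iff)
  ultimately show ?thesis using z0 t by (metis add.right_neutral add_cancel_right_right mult_eq_0_iff
    order_less_irrefl)
qed

lemma interior_triangle:
  assumes "ccw a b c"
  shows "interior (convex hull {a, b, c}) = open_triangle (a, b, c)"
proof
  show "open_triangle (a, b, c) \<subseteq> interior (convex hull {a, b, c})"
    by (rule interior_maximal[OF _ open_open_triangle])
       (auto simp: mem_triangle_iff[OF assms] open_triangle_iff)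
  \<comment> \<open>An affine function that is nonnegative on \<open>S\<close> and not constant
    cannot vanish at an interior point \<open>z\<close>: at a nearby \<open>w\<close> or at its
    mirror image \<open>2 * z - w\<close> it would be negative.\<close>
  have pos: "ccw x y z"
    if xy: "x \<noteq> y" and z: "z \<in> interior S" and S: "\<And>w. w \<in> S \<Longrightarrow> 0
      \<le> crs x y w" for x y z S
  proof (rule ccontr)
    assume "\<not> ccw x y z"
    then have 0: "crs x y z = 0" using S z interior_subset by (metis in_mono order_le_less)
    have "open ((\<lambda>w. 2 * z - w) -` interior S)"
      by (intro open_vimage continuous_intros open_interior)
    then have "open (interior S \<inter> (\<lambda>w. 2 * z - w) -` interior S)"
      by auto
    moreover have "z \<in> interior S \<inter> (\<lambda>w. 2 * z - w) -` interior S" using z by simp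
    ultimately obtain w where w: "w \<in> interior S" "2 * z - w \<in> interior S" "crs x y w \<noteq> 0"
      using crs_nonzero_near[OF xy, of "interior S \<inter> (\<lambda>w. 2 * z - w) -` interior S"] by blast
    have "crs x y (2 * z - w) = 2 * crs x y z - crs x y w"
      by (simp add: crs_expand algebra_simps)
    then show False using w 0 S interior_subset by (smt (verit, best) in_mono)
  qed
  show "interior (convex hull {a, b, c}) \<subseteq> open_triangle (a, b, c)"
    using ccw_distinct[OF assms] mem_triangle_iff[OF assms]
    by (auto simp: open_triangle_iff intro!: pos[where S = "convex hull {a, b, c}"])
qed

lemma open_triangle_nonempty:
  assumes "ccw a b c"
  shows "(a + b + c) / 3 \<in> open_triangle (a, b, c)"
proof -
  have "crs x y ((x + y + z) / 3) = crs x y z / 3" for x y z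
    by (simp add: crs_expand field_simps)
  from this[of a b c] this[of b c a] this[of c a b] assms show ?thesis
    by (simp add: open_triangle_iff add_ac crs_rotate)
qed

lemma closure_open_triangle:
  assumes "ccw a b c"
  shows "closure (open_triangle (a, b, c)) = convex hull {a, b, c}"
proof -
  have "interior (convex hull {a, b, c}) \<noteq> {}"
    using open_triangle_nonempty[OF assms] interior_triangle[OF assms] by auto
  then have "closure (interior (convex hull {a, b, c})) = closure (convex hull {a, b, c})"
    by (intro convex_closure_interior) auto
  then show ?thesis
    by (simp add: interior_triangle[OF assms] finite_imp_compact_convex_hull compact_imp_closed)
qed

lemma frontier_open_triangle:
  assumes "ccw a b c"
  shows "frontier (open_triangle (a, b, c)) = closed_segment a b \<union> closed_segment b c
    \<union> closed_segment a c"
proof -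
  have "frontier (open_triangle (a, b, c)) = frontier (convex hull {a, b, c})"
    using closure_open_triangle[OF assms] interior_triangle[OF assms]
    by (simp add: frontier_def interior_open[OF open_open_triangle] finite_imp_compact_convex_hull
        compact_imp_closed)
  then show ?thesis
    by (simp add: frontier_of_triangle closed_segment_commute)
qed

lemma triangle_minus_sides:
  assumes "ccw a b c" "z \<in> convex hull {a, b, c}"
    "z \<notin> closed_segment a b" "z \<notin> closed_segment b c" "z \<notin> closed_segment c a"
  shows "z \<in> open_triangle (a, b, c)"
  using assms interior_of_triangle[of a b c] by (simp add: interior_triangle)

lemma winding_triangle:
  assumes "ccw a b c" "z \<notin> closed_segment a b" "z \<notin> closed_segment b c"
    "z \<notin> closed_segment c a"
  shows "winding_number (linepath a b) z + winding_number (linepath b c) z + winding_number (linepath c a) z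
       = (if z \<in> open_triangle (a, b, c) then 1 else 0)"
proof -
  have join: "winding_number (linepath a b) z + winding_number (linepath b c) z + winding_number
    (linepath c a) z
     = winding_number (linepath a b +++ linepath b c +++ linepath c a) z"
    using assms by (simp add: winding_number_join path_image_join add.assoc)
  show ?thesis
  proof (cases "z \<in> open_triangle (a, b, c)")
    case True
    then have "z \<in> interior (convex hull {a, b, c})" by (simp add: interior_triangle assms)
    moreover have "Im ((b - a) * cnj (b - z)) = crs a b z"
      by (simp add: crs_expand algebra_simps)
    ultimately show ?thesis
      unfolding join using True by (simp add: winding_number_triangle open_triangle_iff)
  next
    case False
    then have "z \<notin> convex hull {a, b, c}"
      using triangle_minus_sides assms by blast
    moreover have "path_image (linepath a b +++ linepath b c +++ linepath c a) \<subseteq> convex hull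
      {a, b, c}"
      by (auto simp: path_image_join segment_convex_hull intro: subsetD[OF hull_mono, rotated])
    ultimately show ?thesis
      unfolding join using False
      by (simp add: winding_number_zero_outside[where s = "convex hull {a, b, c}"])
  qed
qed

section \<open>Oriented triangulations\<close>

definition rotations :: "'a \<times> 'a \<times> 'a \<Rightarrow> ('a \<times> 'a \<times> 'a) set" where
  "rotations = (\<lambda>(a, b, c). {(a, b, c), (b, c, a), (c, a, b)})"

lemma rotations_simp [simp]: "rotations (a, b, c) = {(a, b, c), (b, c, a), (c, a, b)}"
  by (simp add: rotations_def)

lemma rotations_crs: "(x, y, z) \<in> rotations (a, b, c) \<Longrightarrow> crs x y z = crs a b c"
  using crs_rotate[of b c a] crs_rotate[of c a b] by (auto simp del: crs_rotate)

lemma rotations_open_triangle: "g \<in> rotations f \<Longrightarrow> open_triangle g = open_triangle f"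
  by (cases f) (auto simp: open_triangle_iff)

definition arcs :: "('a \<times> 'a \<times> 'a) set \<Rightarrow> ('a \<times> 'a) set" where
  "arcs F = {(a, b). \<exists>c. (a, b, c) \<in> F}"

definition vertices :: "('a \<times> 'a \<times> 'a) set \<Rightarrow> 'a set" where
  "vertices F = fst ` F"

definition graph :: "('a \<times> 'a \<times> 'a) set \<Rightarrow> 'a ugraph" where
  "graph F = \<lparr>verts = vertices F, edges = {{a, b} | a b. (a, b) \<in> arcs F}\<rparr>"

text \<open>Every triangle occurs in all three rotations, so that each arc \<open>(a, b)\<close> belongs
  to exactly one
  oriented triangle. All of them are counterclockwise except the outer one, which bounds the unbounded
  face and is therefore clockwise.\<close>

locale oriented_triangulation =
  fixes F :: "(complex \<times> complex \<times> complex) set" and A B C :: complex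
  assumes finite_F: "finite F"
    and rotate: "(a, b, c) \<in> F \<Longrightarrow> (b, c, a) \<in> F"
    and unique: "(a, b, c) \<in> F \<Longrightarrow> (a, b, d) \<in> F \<Longrightarrow> c = d"
    and arcs_sym: "(a, b) \<in> arcs F \<Longrightarrow> (b, a) \<in> arcs F"
    and outer: "(A, B, C) \<in> F"
    and ccw_outer: "ccw B A C"
    and ccw_inner: "(a, b, c) \<in> F \<Longrightarrow> (a, b, c) \<in> rotations (A, B, C) \<or> ccw a b c"
begin

definition inner :: "(complex \<times> complex \<times> complex) set" where
  "inner = {(a, b, c) \<in> F. ccw a b c}"

text \<open>The generic points, where the winding numbers along all edges are meaningful. By
  \<open>ex_off_edges\<close> every nonempty open set contains one.\<close>

definition off_edges :: "complex \<Rightarrow> bool" where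
  "off_edges z \<longleftrightarrow> (\<forall>a b. (a, b) \<in> arcs F \<longrightarrow> z \<notin>
    closed_segment a b)"

lemma rotate': "(a, b, c) \<in> F \<Longrightarrow> (c, a, b) \<in> F"
  using rotate by blast

lemma arcsI: "(a, b, c) \<in> F \<Longrightarrow> (a, b) \<in> arcs F \<and> (b, c) \<in> arcs F
  \<and> (c, a) \<in> arcs F"
  unfolding arcs_def using rotate rotate' by blast

lemma F_split: "F = inner \<union> rotations (A, B, C)" "inner \<inter> rotations (A, B, C) = {}"
proof -
  show "F = inner \<union> rotations (A, B, C)"
    using ccw_inner outer rotate[OF outer] rotate'[OF outer] by (fastforce simp: inner_def)
  have "crs A B C < 0" "crs B C A < 0" "crs C A B < 0"
    using ccw_outer crs_swap[of A B C] crs_rotate[of A B C] crs_rotate[of C A B] by auto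
  then show "inner \<inter> rotations (A, B, C) = {}"
    by (auto simp: inner_def)
qed

lemma finite_arcs: "finite (arcs F)"
proof -
  have "arcs F = (\<lambda>(a, b, c). (a, b)) ` F" by (force simp: arcs_def)
  then show ?thesis using finite_F by simp
qed

lemma outer_distinct: "A \<noteq> B" "B \<noteq> C" "A \<noteq> C"
  using ccw_outer by auto

lemma arc_distinct: "(a, b) \<in> arcs F \<Longrightarrow> a \<noteq> b"
  using ccw_inner outer_distinct unfolding arcs_def by fastforce

lemma winding_sum_zero:
  assumes z: "off_edges z"
  defines "I \<equiv> \<lambda>a b. winding_number (linepath a b) z"
  shows "(\<Sum>(a, b, c)\<in>F. I a b + I b c + I c a) = 0"
proof -
  let ?X = "\<Sum>(a, b)\<in>arcs F. I a b"
  \<comment> \<open>\<open>?r\<close> permutes \<open>F\<close>, and each arc starts exactly one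
    triple, so each of the three partial sums equals the sum \<open>?X\<close> over all arcs.
    Reversing the arcs then gives \<open>?X = - ?X\<close>.\<close>
  let ?r = "\<lambda>(a, b, c). (b, c, a :: complex)"
  have r_inj: "inj ?r" by (auto simp: inj_def)
  have "?r ` F \<subseteq> F" by (clarsimp, erule rotate)
  then have r_img: "?r ` F = F"
    using endo_inj_surj[OF finite_F] inj_on_subset[OF r_inj subset_UNIV] by blast
  have "inj_on (\<lambda>(a, b, c). (a, b)) F" using unique by (auto simp: inj_on_def)
  moreover have "arcs F = (\<lambda>(a, b, c). (a, b)) ` F" by (force simp: arcs_def)
  ultimately have "?X = (\<Sum>f\<in>F. ((\<lambda>(a, b). I a b) \<circ> (\<lambda>(a, b, c). (a, b))) f)"
    by (simp only: sum.reindex)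
  then have 1: "(\<Sum>(a, b, c)\<in>F. I a b) = ?X"
    by (simp add: case_prod_beta comp_def)
  have step: "(\<Sum>f\<in>F. g (?r f)) = (\<Sum>f\<in>F. g f)" for g :: "_ \<Rightarrow> complex"
    using sum.reindex[OF inj_on_subset[OF r_inj subset_UNIV], where A = F and g = g] r_img by (simp add:
      comp_def)
  have 2: "(\<Sum>(a, b, c)\<in>F. I b c) = ?X"
    using step[of "\<lambda>(a, b, c). I a b"] 1 by (simp add: case_prod_beta)
  have 3: "(\<Sum>(a, b, c)\<in>F. I c a) = ?X"
    using step[of "\<lambda>(a, b, c). I b c"] 2 by (simp add: case_prod_beta)
  have "prod.swap ` arcs F = arcs F"
  proof -
    have "prod.swap ` arcs F \<subseteq> arcs F" by (clarsimp, erule arcs_sym)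
    then have "prod.swap ` prod.swap ` arcs F \<subseteq> prod.swap ` arcs F" by (rule image_mono)
    then show ?thesis using \<open>prod.swap ` arcs F \<subseteq> arcs F\<close> by (simp add: image_image)
  qed
  then have "?X = (\<Sum>(a, b)\<in>arcs F. I b a)"
    using sum.reindex[of prod.swap "arcs F" "\<lambda>(a, b). I a b"]
    by (simp add: case_prod_beta comp_def)
  also have "\<dots> = (\<Sum>(a, b)\<in>arcs F. - I a b)"
  proof (intro sum.cong refl)
    fix e assume "e \<in> arcs F"
    obtain a b where e: "e = (a, b)" by force
    then have "z \<notin> closed_segment a b" using z \<open>e \<in> arcs F\<close> by (auto simp:
      off_edges_def)
    then show "(case e of (a, b) \<Rightarrow> I b a) = (case e of (a, b) \<Rightarrow> - I a b)"
      using winding_number_reversepath[of "linepath a b" z] by (simp add: e I_def)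
  qed
  also have "\<dots> = - ?X" by (simp add: case_prod_beta sum_negf)
  finally have "?X = 0" by simp
  have "(\<Sum>(a, b, c)\<in>F. I a b + I b c + I c a) = ?X + ?X + ?X"
    using 1 2 3 by (simp add: case_prod_beta sum.distrib)
  then show ?thesis using \<open>?X = 0\<close> by simp
qed

text \<open>The winding numbers of all oriented triangles around \<open>z\<close> cancel, because every
  arc occurs together
  with its reverse. So each generic point of the outer triangle lies in exactly one inner triangle, which
  is counted once for each of its rotations.\<close>

lemma cover_count:
  assumes z: "off_edges z"
  shows "card {f \<in> inner. z \<in> open_triangle f} = (if z \<in> open_triangle (B, A, C) then 3 else 0)"
proof -
  define I where "I = (\<lambda>a b. winding_number (linepath a b) z)"
  define w where "w = (\<lambda>(a, b, c). I a b + I b c + I c a)"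
  have fin: "finite inner" using finite_F F_split(1) by (metis finite_Un)
  have seg: "z \<notin> closed_segment a b" if "(a, b) \<in> arcs F" for a b
    using z that by (auto simp: off_edges_def)
  have w_inner: "w f = (if z \<in> open_triangle f then 1 else 0)" if f: "f \<in> inner" for f
  proof -
    obtain a b c where abc: "f = (a, b, c)" by (cases f)
    with f have "(a, b, c) \<in> F" "ccw a b c" by (auto simp: inner_def)
    with arcsI seg show ?thesis
      by (auto simp: abc w_def I_def winding_triangle)
  qed
  have outer_arcs: "(A, B) \<in> arcs F" "(B, C) \<in> arcs F" "(C, A) \<in> arcs F"
    using arcsI[OF outer] by auto
  then have out_arcs': "(B, A) \<in> arcs F" "(C, B) \<in> arcs F" "(A, C) \<in> arcs F"
    by (auto intro: arcs_sym)
  have rev: "I b a = - I a b" if "(a, b) \<in> arcs F" for a b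
    using winding_number_reversepath[of "linepath a b" z] seg[OF that] by (simp add: I_def)
  have "I B A + I A C + I C B = (if z \<in> open_triangle (B, A, C) then 1 else 0)"
    unfolding I_def using winding_triangle[OF ccw_outer] seg out_arcs' by auto
  moreover have "I A B + I B C + I C A = - (I B A + I A C + I C B)"
    using rev[OF outer_arcs(1)] rev[OF outer_arcs(2)] rev[OF outer_arcs(3)] by simp
  ultimately have w_out: "I A B + I B C + I C A = - (if z \<in> open_triangle (B, A, C) then 1 else 0)"
    by simp
  have w_rot: "w (b, c, a) = w (a, b, c)" for a b c by (simp add: w_def)
  have "(\<Sum>f\<in>rotations (A, B, C). w f) = 3 * w (A, B, C)"
    using outer_distinct by (simp add: w_rot[of A B C] w_rot[of C A B])
  also have "\<dots> = - (if z \<in> open_triangle (B, A, C) then 3 else 0)"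
    using w_out by (simp add: w_def)
  finally have 1: "(\<Sum>f\<in>rotations (A, B, C). w f) = - (if z \<in> open_triangle (B, A, C) then 3
    else 0)" .
  have "0 = (\<Sum>f\<in>F. w f)"
    using winding_sum_zero[OF z] by (simp add: w_def I_def case_prod_beta)
  also have "\<dots> = (\<Sum>f\<in>inner. w f) + (\<Sum>f\<in>rotations (A, B, C). w f)"
    using F_split fin by (subst F_split(1), intro sum.union_disjoint) auto
  also have "(\<Sum>f\<in>inner. w f) = of_nat (card {f \<in> inner. z \<in> open_triangle f})"
    using fin by (simp add: w_inner sum.If_cases Int_def)
  finally have "of_nat (card {f \<in> inner. z \<in> open_triangle f})
      = (of_nat (if z \<in> open_triangle (B, A, C) then 3 else 0) :: complex)"
    unfolding 1 by (simp split: if_splits)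
  then show ?thesis
    unfolding of_nat_eq_iff .
qed

text \<open>Segments are closed and have empty interior, so finitely many of them cannot exhaust a
  nonempty open set.\<close>

lemma ex_off_edges:
  assumes "open U" "U \<noteq> {}"
  shows "\<exists>z\<in>U. off_edges z"
proof -
  have "\<exists>z\<in>U. \<forall>e\<in>E. z \<notin> closed_segment (fst e) (snd e)"
    if "finite E" "open U" "U \<noteq> {}" for E :: "(complex \<times> complex) set" and U
    using that
  proof (induction E arbitrary: U)
    case (insert e E)
    let ?U = "U - closed_segment (fst e) (snd e)"
    have "?U \<noteq> {}"
    proof
      assume "?U = {}"
      then have "U \<subseteq> interior (closed_segment (fst e) (snd e))"
        using insert.prems by (intro interior_maximal) auto
      then show False using insert.prems by (auto simp: interior_closed_segment_ge2)
    qed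
    moreover have "open ?U" using insert.prems by (intro open_Diff) auto
    ultimately show ?case using insert.IH[of ?U] by auto
  qed auto
  from this[OF finite_arcs assms] show ?thesis by (fastforce simp: off_edges_def)
qed

text \<open>A generic common point would lie in the three rotations of \<open>f\<close> and also in
  \<open>g\<close>, one triple more than \<open>cover_count\<close> allows.\<close>

lemma inner_disjoint:
  assumes "f \<in> inner" "g \<in> inner" "open_triangle f \<inter> open_triangle g \<noteq> {}"
  shows "g \<in> rotations f"
proof (rule ccontr)
  assume g: "g \<notin> rotations f"
  obtain z where z: "z \<in> open_triangle f" "z \<in> open_triangle g" "off_edges z"
    using ex_off_edges[of "open_triangle f \<inter> open_triangle g"] assms(3) open_open_triangle
    by (auto simp: open_Int)
  obtain a b c where f: "f = (a, b, c)" by (cases f)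
  have d: "a \<noteq> b" "b \<noteq> c" "a \<noteq> c" using assms(1) by (auto simp: f inner_def)
  have "insert g (rotations f) \<subseteq> {h \<in> inner. z \<in> open_triangle h}"
    using z assms rotate[of a b c] rotate'[of a b c] by (auto simp: f inner_def open_triangle_iff crs_rotate)
  moreover have "finite {h \<in> inner. z \<in> open_triangle h}"
    using finite_F by (auto simp: inner_def intro: finite_subset)
  ultimately have "card (insert g (rotations f)) \<le> card {h \<in> inner. z \<in> open_triangle h}"
    by (rule card_mono[rotated])
  moreover have "card (insert g (rotations f)) = 4"
    using g d by (simp add: f)
  ultimately show False using cover_count[OF z(3)] by (simp split: if_splits)
qed

lemma inner_subset: 
  assumes "f \<in> inner"
  shows "open_triangle f \<subseteq> open_triangle (B, A, C)"
proof -
  let ?D = "convex hull {B, A, C}"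
  have "open_triangle f \<subseteq> ?D"
  proof (rule ccontr)
    assume "\<not> open_triangle f \<subseteq> ?D"
    then have "open_triangle f - ?D \<noteq> {}" by auto
    moreover have "open (open_triangle f - ?D)"
      by (intro open_Diff open_open_triangle) (simp add: finite_imp_compact_convex_hull compact_imp_closed)
    ultimately obtain z where z: "z \<in> open_triangle f" "z \<notin> ?D" "off_edges z"
      using ex_off_edges by blast
    then have "z \<notin> open_triangle (B, A, C)"
      using interior_triangle[OF ccw_outer] interior_subset by auto
    moreover have "finite {h \<in> inner. z \<in> open_triangle h}"
      using finite_F by (auto simp: inner_def intro: finite_subset)
    moreover have "f \<in> {h \<in> inner. z \<in> open_triangle h}" using z assms by blast
    ultimately have "card {h \<in> inner. z \<in> open_triangle h} \<noteq> 0" by (metis card_0_eq empty_iff)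
    then show False using cover_count[OF z(3)] \<open>z \<notin> open_triangle (B, A, C)\<close> by simp
  qed
  then show ?thesis
    using interior_triangle[OF ccw_outer] interior_maximal open_open_triangle by metis
qed

lemma inner_cover:
  assumes "off_edges z" "z \<in> open_triangle (B, A, C)"
  shows "\<exists>f\<in>inner. z \<in> open_triangle f"
proof (rule ccontr)
  assume "\<not> ?thesis"
  then have *: "{f \<in> inner. z \<in> open_triangle f} = {}" by blast
  show False using cover_count[OF assms(1)] assms(2) unfolding * by simp
qed

lemma inner_hull_subset:
  assumes "(a, b, c) \<in> inner"
  shows "convex hull {a, b, c} \<subseteq> convex hull {B, A, C}"
proof -
  have "ccw a b c" using assms by (simp add: inner_def)
  then show ?thesis
    using closure_mono[OF inner_subset[OF assms]] closure_open_triangle ccw_outer by metis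
qed

section \<open>The two triangles along an edge\<close>

lemma arc_inner_cases:
  assumes "(a, b) \<in> arcs F"
  shows "(\<exists>c. (a, b, c) \<in> inner) \<or> (\<exists>c. (b, a, c) \<in> inner)"
proof -
  obtain c d where "(a, b, c) \<in> F" "(b, a, d) \<in> F"
    using assms arcs_sym[OF assms] by (auto simp: arcs_def)
  moreover have "(a, b, c) \<in> inner \<or> (b, a, d) \<in> inner"
  proof (rule ccontr)
    assume "\<not> ?thesis"
    with \<open>(a, b, c) \<in> F\<close> \<open>(b, a, d) \<in> F\<close> F_split(1)
    have "(a, b, c) \<in> rotations (A, B, C)" "(b, a, d) \<in> rotations (A, B, C)" by blast+
    with outer_distinct show False by auto
  qed
  ultimately show ?thesis by blast
qed

text \<open>If the triangle is inner, its other two orientation tests hold near \<open>q\<close> by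
  continuity, so only the side of \<open>a b\<close> matters. If it is the outer one, it is
  clockwise, and the left side of \<open>a b\<close> is outside the whole drawing.\<close>

lemma near_edge:
  assumes e: "(a, b, c) \<in> F" and q: "q \<in> open_segment a b"
  shows "\<exists>U. open U \<and> q \<in> U \<and> (\<forall>z\<in>U. ccw a b z \<longrightarrow>
    ((a, b, c) \<in> inner \<and> z \<in> open_triangle (a, b, c)) \<or> z \<notin> convex hull {B, A, C})"
proof (cases "(a, b, c) \<in> inner")
  case True
  then have abc: "ccw a b c" by (simp add: inner_def)
  obtain t where t: "0 < t" "t < 1" "q = (1 - t) *\<^sub>R a + t *\<^sub>R b"
    using q by (auto simp: in_segment)
  have "crs b c q = (1 - t) * crs a b c" "crs c a q = t * crs a b c"
    unfolding t by (simp_all add: crs_expand algebra_simps)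
  then have "ccw b c q" "ccw c a q" using t abc by auto
  moreover have "open {z. ccw b c z \<and> ccw c a z}"
    by (intro open_Collect_conj open_Collect_less continuous_intros)
  ultimately show ?thesis
    using True by (intro exI[of _ "{z. ccw b c z \<and> ccw c a z}"]) (auto simp: open_triangle_iff)
next
  case False
  then have r: "(a, b, c) \<in> rotations (A, B, C)" using e False F_split(1) by blast
  consider "a = A" "b = B" "c = C" | "a = B" "b = C" "c = A" | "a = C" "b = A" "c = B"
    using r by auto
  then have "{b, a, c} = {B, A, C}"
    by cases blast+
  moreover have "ccw b a c"
  proof -
    have "ccw C B A" "ccw A C B"
      using ccw_outer by (simp_all only: crs_rotate[of C B A] crs_rotate[of B A C])
    then show ?thesis using r ccw_outer by auto
  qed
  ultimately have eq: "convex hull {B, A, C} = convex hull {b, a, c}" "ccw b a c"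
    by simp_all
  have "z \<notin> convex hull {B, A, C}" if "ccw a b z" for z
    using that eq by (simp add: mem_triangle_iff crs_swap[of b a])
  then show ?thesis by (intro exI[of _ UNIV]) auto
qed

text \<open>The triangle has points near \<open>q\<close> that are off the line \<open>a b\<close>.
  On either side \<open>near_edge\<close> places such a point in a triangle at the edge, and
  different inner triangles are disjoint.\<close>

lemma faces_at_edge_point:
  assumes e: "(a, b, c) \<in> F" "(b, a, d) \<in> F" and q: "q \<in> open_segment a b"
    and f: "(x, y, w) \<in> inner" "q \<in> convex hull {x, y, w}"
  shows "(x, y, w) \<in> rotations (a, b, c) \<union> rotations (b, a, d)"
proof -
  have ab: "a \<noteq> b" using q by auto
  have xyw: "ccw x y w" using f by (simp add: inner_def)
  obtain U where U: "open U" "q \<in> U" "\<And>z. z \<in> U \<Longrightarrow> ccw a b z \<Longrightarrow>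
      ((a, b, c) \<in> inner \<and> z \<in> open_triangle (a, b, c)) \<or> z \<notin> convex hull {B, A, C}"
    using near_edge[OF e(1) q] by blast
  obtain V where V: "open V" "q \<in> V" "\<And>z. z \<in> V \<Longrightarrow> ccw b a z \<Longrightarrow>
      ((b, a, d) \<in> inner \<and> z \<in> open_triangle (b, a, d)) \<or> z \<notin> convex hull {B, A, C}"
    using near_edge[OF e(2)] q by (metis open_segment_commute)
  let ?N = "U \<inter> V \<inter> open_triangle (x, y, w)"
  have "q \<in> closure (open_triangle (x, y, w))"
    using f closure_open_triangle[OF xyw] by simp
  moreover have "open (U \<inter> V)" "q \<in> U \<inter> V" using U V by (auto simp: open_Int)
  ultimately have "?N \<noteq> {}"
    using open_Int_closure_eq_empty[of "U \<inter> V" "open_triangle (x, y, w)"] by blast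
  moreover have "open ?N" using U V open_open_triangle by (simp add: open_Int)
  ultimately obtain z where z: "z \<in> ?N" "crs a b z \<noteq> 0"
    using crs_nonzero_near[OF ab] by blast
  have D: "z \<in> convex hull {B, A, C}"
    using z(1) inner_subset[OF f(1)] interior_triangle[OF ccw_outer] interior_subset by blast
  show ?thesis
  proof (cases "ccw a b z")
    case True
    then have "(a, b, c) \<in> inner" "z \<in> open_triangle (a, b, c)" using U(3) z D by auto
    then show ?thesis using inner_disjoint[OF _ f(1), of "(a, b, c)"] z by blast
  next
    case False
    then have "ccw b a z" using z(2) by (simp add: crs_swap[of b a])
    then have "(b, a, d) \<in> inner" "z \<in> open_triangle (b, a, d)" using V(3) z D by auto
    then show ?thesis using inner_disjoint[OF _ f(1), of "(b, a, d)"] z by blast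
  qed
qed

text \<open>The edge \<open>x y\<close> is a side of an inner triangle, which by
  \<open>faces_at_edge_point\<close> is one of the two at \<open>a b\<close>. Their other sides
  touch the line \<open>a b\<close> only in \<open>a\<close> or \<open>b\<close>, so the side
  through \<open>q\<close> must be \<open>a b\<close> itself.\<close>

lemma edge_interior_meets:
  assumes ab: "(a, b) \<in> arcs F" and q: "q \<in> open_segment a b"
    and xy: "(x, y) \<in> arcs F" "q \<in> closed_segment x y"
  shows "{x, y} = {a, b}"
proof -
  obtain c d where cd: "(a, b, c) \<in> F" "(b, a, d) \<in> F"
    using ab arcs_sym[OF ab] by (auto simp: arcs_def)
  have ends: "q \<noteq> a" "q \<noteq> b" using q by (auto simp: open_segment_def)
  have crs0: "crs a b q = 0"
  proof -
    obtain t where t: "q = (1 - t) *\<^sub>R a + t *\<^sub>R b" using q by (auto simp: in_segment)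
    show ?thesis unfolding t by (simp add: crs_expand algebra_simps)
  qed
  have side: "q \<notin> closed_segment u v" if "crs a b u \<noteq> 0" "v = a \<or> v = b" for u v
  proof
    assume "q \<in> closed_segment u v"
    then obtain t where t: "0 \<le> t" "t \<le> 1" "q = (1 - t) *\<^sub>R u + t *\<^sub>R v"
      by (auto simp: in_segment)
    have "crs a b q = (1 - t) * crs a b u + t * crs a b v"
      unfolding t by (simp add: crs_expand algebra_simps)
    with that crs0 have "t = 1" by auto
    then show False using t ends that by auto
  qed
  obtain x' y' w where f: "(x', y', w) \<in> inner" "{x', y'} = {x, y}"
    using arc_inner_cases[OF xy(1)] by (metis insert_commute)
  have "q \<in> convex hull {x', y', w}"
  proof -
    have "q \<in> convex hull {x', y'}" using xy(2) f(2) by (simp add: segment_convex_hull)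
    then show ?thesis by (rule subsetD[OF hull_mono, rotated]) auto
  qed
  then have "(x', y', w) \<in> rotations (a, b, c) \<union> rotations (b, a, d)"
    using faces_at_edge_point[OF cd q f(1)] by blast
  moreover have "crs x' y' w > 0" using f(1) by (simp add: inner_def)
  moreover have "q \<in> closed_segment x' y'" using xy(2) f(2)
    by (metis closed_segment_commute doubleton_eq_iff)
  moreover have "crs a b c \<noteq> 0" if "(x', y', w) \<in> rotations (a, b, c)"
    using rotations_crs[OF that] \<open>crs x' y' w > 0\<close> by simp
  moreover have "crs a b d \<noteq> 0" if "(x', y', w) \<in> rotations (b, a, d)"
    using rotations_crs[OF that] \<open>crs x' y' w > 0\<close> crs_swap[of a b d] by simp
  moreover have "q \<notin> closed_segment c a"
    "q \<notin> closed_segment c b" if "crs a b c \<noteq> 0" for c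
    using side[OF that] by blast+
  moreover have "q \<notin> closed_segment a c"
    "q \<notin> closed_segment b c" if "crs a b c \<noteq> 0" for c
    using side[OF that, of a] side[OF that, of b] by (simp_all add: closed_segment_commute[of _ c])
  ultimately have "{x', y'} = {a, b}"
    unfolding Un_iff rotations_simp insert_iff empty_iff prod.inject by blast
  then show ?thesis using f(2) by simp
qed

section \<open>The straight-line drawing and its faces\<close>

lemma vertices_iff: "v \<in> vertices F \<longleftrightarrow> (\<exists>b. (v, b) \<in> arcs F)"
  by (force simp: vertices_def arcs_def)

lemma vertices_F: "(a, b, c) \<in> F \<Longrightarrow> a \<in> vertices F
  \<and> b \<in> vertices F \<and> c \<in> vertices F"
  using arcsI vertices_iff by blast

lemma verts_graph [simp]: "verts (graph F) = vertices F"
  by (simp add: graph_def)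

lemma edges_graph: "edges (graph F) = {{a, b} | a b. (a, b) \<in> arcs F}"
  by (simp add: graph_def)

lemma edges_graph_iff [simp]: "{a, b} \<in> edges (graph F) \<longleftrightarrow> (a, b) \<in> arcs F"
  unfolding edges_graph by (auto simp: doubleton_eq_iff dest: arcs_sym[of b a])

lemma simple_graph: "simple_graph (graph F)"
proof -
  have "finite (vertices F)" unfolding vertices_def using finite_F by simp
  moreover have "{a, b} \<subseteq> vertices F \<and> card {a, b} = 2" if "(a, b) \<in> arcs F" for a b
    using that arcs_sym[OF that] arc_distinct[OF that] vertices_iff by auto
  ultimately show ?thesis by (auto simp: simple_graph_def edges_graph)
qed

lemma edge_vertices:
  assumes "(a, b) \<in> arcs F" "v \<in> vertices F" "v \<in> closed_segment a b"
  shows "v \<in> {a, b}"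
proof (rule ccontr)
  assume "v \<notin> {a, b}"
  then have v: "v \<in> open_segment a b" using assms by (auto simp: open_segment_def)
  obtain y where "(v, y) \<in> arcs F" using assms vertices_iff by auto
  then have "{v, y} = {a, b}" using edge_interior_meets[OF assms(1) v] by auto
  with \<open>v \<notin> {a, b}\<close> show False by auto
qed

lemma plane_graph: "plane_graph (graph F) (\<lambda>e. convex hull e)"
  unfolding plane_graph_def
proof (intro conjI allI impI ballI)
  show "simple_graph (graph F)" by (rule simple_graph)
  show "\<exists>g. arc g \<and> pathstart g = u \<and> pathfinish g = v
    \<and> path_image g = convex hull {u, v}"
    if "{u, v} \<in> edges (graph F)" for u v
    using that arc_distinct
    by (intro exI[of _ "linepath u v"]) (auto simp: arc_linepath segment_convex_hull)
  show "convex hull e \<inter> verts (graph F) = e" if e: "e \<in> edges (graph F)" for e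
  proof -
    obtain a b where ab: "e = {a, b}" "(a, b) \<in> arcs F" using e by (auto simp: edges_graph)
    have "e \<subseteq> vertices F" using e simple_graph by (auto simp: simple_graph_def)
    then show ?thesis
      using edge_vertices[OF ab(2)] hull_subset[of e convex] by (auto simp: ab segment_convex_hull)
  qed
  show "convex hull e \<inter> convex hull e' \<subseteq> e \<inter> e'"
    if e: "e \<in> edges (graph F)" "e' \<in> edges (graph F)" "e \<noteq> e'" for e e'
  proof
    fix q assume q: "q \<in> convex hull e \<inter> convex hull e'"
    obtain a b where ab: "e = {a, b}" "(a, b) \<in> arcs F" using e by (auto simp: edges_graph)
    obtain x y where xy: "e' = {x, y}" "(x, y) \<in> arcs F" using e by (auto simp: edges_graph)
    have q': "q \<in> closed_segment a b" "q \<in> closed_segment x y"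
      using q by (auto simp: ab xy segment_convex_hull)
    have "q \<notin> open_segment a b" "q \<notin> open_segment x y"
      using edge_interior_meets[OF ab(2) _ xy(2)] edge_interior_meets[OF xy(2) _ ab(2)] q' e(3) ab xy
      by auto
    then show "q \<in> e \<inter> e'" using q' by (auto simp: open_segment_def ab xy)
  qed
qed

definition drawing :: "complex set" where
  "drawing = verts (graph F) \<union> (\<Union>e\<in>edges (graph F). convex hull e)"

lemma notin_drawing: "z \<notin> drawing \<longleftrightarrow> off_edges z"
proof -
  have "vertices F \<subseteq> (\<Union>e\<in>edges (graph F). convex hull e)"
    using vertices_iff by (auto simp: edges_graph) (metis hull_inc insertI1)
  then have "drawing = (\<Union>(a, b)\<in>arcs F. closed_segment a b)"
    by (auto simp: drawing_def edges_graph segment_convex_hull)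
  then show ?thesis by (auto simp: off_edges_def)
qed

text \<open>If \<open>z\<close> is inside an edge, then \<open>f\<close> is one of the two triangles
  at that edge, and these lie strictly on one side of it. If \<open>z\<close> is a vertex, it is in
  the closure of some inner triangle that has it as a corner; this triangle would meet
  \<open>f\<close> and hence agree with it, but a corner is not in the open triangle.\<close>

lemma off_edges_inner:
  assumes f: "f \<in> inner" and z: "z \<in> open_triangle f"
  shows "off_edges z"
  unfolding off_edges_def
proof (intro allI impI notI)
  fix a b assume ab: "(a, b) \<in> arcs F" and zab: "z \<in> closed_segment a b"
  obtain x y w where xyw: "f = (x, y, w)" by (cases f)
  have corner: "v \<notin> open_triangle g" if "g \<in> rotations (v, v', v'')" for v v' v'' g
    using that by (auto simp: open_triangle_iff)
  show False
  proof (cases "z \<in> open_segment a b")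
    case True
    obtain c d where cd: "(a, b, c) \<in> F" "(b, a, d) \<in> F"
      using ab arcs_sym[OF ab] by (auto simp: arcs_def)
    have "z \<in> convex hull {x, y, w}"
      using z f interior_triangle[of x y w] interior_subset by (auto simp: xyw inner_def)
    then have "(x, y, w) \<in> rotations (a, b, c) \<union> rotations (b, a, d)"
      using faces_at_edge_point[OF cd True] f by (auto simp: xyw)
    moreover have "crs a b z = 0"
    proof -
      obtain t where t: "z = (1 - t) *\<^sub>R a + t *\<^sub>R b" using True by (auto simp: in_segment)
      show ?thesis unfolding t by (simp add: crs_expand algebra_simps)
    qed
    moreover have "z \<in> open_triangle (a, b, c) \<or> z \<in> open_triangle (b, a, d)"
      using calculation(1) z rotations_open_triangle[of f] unfolding xyw by blast
    ultimately show False
      using crs_swap[of a b z] by (auto simp only: open_triangle_iff)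
  next
    case False
    then have "z = a \<or> z = b" using zab by (auto simp: open_segment_def)
    then obtain y' where zy: "(z, y') \<in> arcs F" using ab arcs_sym[OF ab] by auto
    obtain g w' where g: "g \<in> inner" "g = (z, y', w') \<or> g = (y', z, w')"
      using arc_inner_cases[OF zy] by blast
    have "z \<in> closure (open_triangle g)"
    proof -
      have "z \<in> convex hull {z, y', w'}" "z \<in> convex hull {y', z, w'}"
        by (simp_all add: hull_inc)
      then show ?thesis
        using g(2)
      proof (elim disjE)
        assume "g = (z, y', w')" "z \<in> convex hull {z, y', w'}"
        then show ?thesis using g(1) by (simp add: inner_def closure_open_triangle)
      next
        assume "g = (y', z, w')" "z \<in> convex hull {y', z, w'}"
        then show ?thesis using g(1) by (simp add: inner_def closure_open_triangle)
      qed
    qed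
    then have "open_triangle f \<inter> open_triangle g \<noteq> {}"
      using z open_Int_closure_eq_empty[OF open_open_triangle, of f "open_triangle g"] by blast
    then have "f \<in> rotations g" using inner_disjoint[OF g(1) f] by blast
    then show False using g(2) z corner by (auto simp: open_triangle_iff)
  qed
qed

text \<open>Disjoint open connected sets that fill the complement of the drawing are its components.
  Connectedness is convexity for the triangles, and for the unbounded face the fact that the
  complement of a bounded convex set is connected.\<close>

lemma plane_faces:
  "plane_faces (graph F) (\<lambda>e. convex hull e) = insert (- (convex hull {B, A, C})) (open_triangle
    ` inner)"
  unfolding plane_faces_def drawing_def[symmetric]
proof (rule components_open_unique)
  let ?O = "- (convex hull {B, A, C})"
  have "open_triangle (B, A, C) \<subseteq> convex hull {B, A, C}"
    using interior_triangle[OF ccw_outer] interior_subset[of "convex hull {B, A, C}"] by simp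
  then have O: "open_triangle f \<inter> ?O = {}" if "f \<in> inner" for f
    using inner_subset[OF that] by auto
  show "pairwise disjnt (insert ?O (open_triangle ` inner))"
  proof (rule pairwiseI)
    fix X Y assume XY: "X \<in> insert ?O (open_triangle ` inner)"
      "Y \<in> insert ?O (open_triangle ` inner)" "X \<noteq> Y"
    have "open_triangle f \<inter> open_triangle g = {}"
      if "f \<in> inner" "g \<in> inner" "open_triangle f \<noteq> open_triangle g" for f g
      using inner_disjoint[of f g] rotations_open_triangle[of g f] that by blast
    moreover have "?O \<inter> open_triangle f = {}" if "f \<in> inner" for f
      using O[OF that] by (simp only: Int_commute)
    ultimately show "disjnt X Y" using XY O unfolding disjnt_def by blast
  qed
  show "\<Union> (insert ?O (open_triangle ` inner)) = - drawing"
  proof (intro equalityI subsetI)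
    fix z assume z: "z \<in> \<Union> (insert ?O (open_triangle ` inner))"
    show "z \<in> - drawing"
    proof (cases "z \<in> ?O")
      case True
      have "z \<notin> closed_segment a b" if "(a, b) \<in> arcs F" for a b
      proof -
        obtain x y w where f: "(x, y, w) \<in> inner" "{x, y} = {a, b}"
          using arc_inner_cases[OF \<open>(a, b) \<in> arcs F\<close>] by (metis insert_commute)
        have "convex hull {a, b} \<subseteq> convex hull {x, y, w}"
          using f(2) by (intro hull_mono) auto
        then show ?thesis using inner_hull_subset[OF f(1)] True by (auto simp: segment_convex_hull)
      qed
      then show ?thesis using notin_drawing by (auto simp: off_edges_def)
    next
      case False
      then show ?thesis using z off_edges_inner notin_drawing by auto
    qed
  next
    fix z assume "z \<in> - drawing"
    then have off: "off_edges z" using notin_drawing by auto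
    show "z \<in> \<Union> (insert ?O (open_triangle ` inner))"
    proof (cases "z \<in> ?O")
      case False
      have "(B, A) \<in> arcs F" "(A, C) \<in> arcs F" "(C, B) \<in> arcs F"
        using arcsI[OF outer] arcs_sym by blast+
      then have "z \<in> open_triangle (B, A, C)"
        using triangle_minus_sides[OF ccw_outer] False off by (auto simp: off_edges_def)
      then show ?thesis using inner_cover[OF off] by auto
    qed auto
  qed
  show "open X \<and> connected X \<and> X \<noteq> {}" if X: "X \<in> insert ?O (open_triangle `
    inner)" for X
  proof (cases "X = ?O")
    case True
    have "compact (convex hull {B, A, C})" by (simp add: finite_imp_compact_convex_hull)
    moreover have "?O \<noteq> {}"
      using calculation compact_imp_bounded not_bounded_UNIV by (metis Compl_empty_eq double_compl)
    ultimately show ?thesis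
      using True connected_complement_bounded_convex[of "convex hull {B, A, C}"]
      by (auto simp: compact_imp_bounded compact_imp_closed)
  next
    case False
    then obtain a b c where abc: "X = open_triangle (a, b, c)" "ccw a b c"
      using X by (auto simp: inner_def)
    then have "convex X" using interior_triangle by (metis convex_convex_hull convex_interior)
    then show ?thesis
      using abc open_open_triangle open_triangle_nonempty convex_connected by blast
  qed
qed

theorem plane_triangulation: "plane_triangulation (graph F) (\<lambda>e. convex hull e)"
  unfolding plane_triangulation_def
proof (intro conjI ballI plane_graph)
  fix X assume "X \<in> plane_faces (graph F) (\<lambda>e. convex hull e)"
  then consider "X = - (convex hull {B, A, C})" | f where "f \<in> inner" "X = open_triangle f"
    unfolding plane_faces by auto
  then obtain x y z where "(x, y, z) \<in> F" "frontier X = closed_segment x y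
    \<union> closed_segment y z \<union> closed_segment x z"
  proof cases
    case 1
    then have "frontier X = frontier (convex hull {A, B, C})"
      by (simp add: frontier_complement insert_commute)
    then have "frontier X = closed_segment A B \<union> closed_segment B C \<union> closed_segment A C"
      by (simp add: frontier_of_triangle closed_segment_commute)
    then show ?thesis using that outer by auto
  next
    case 2
    then obtain a b c where "f = (a, b, c)" "(a, b, c) \<in> F" "ccw a b c" by (auto simp: inner_def)
    then show ?thesis using that[of a b c] frontier_open_triangle[of a b c] 2 by simp
  qed
  then show "\<exists>x y z. {x, y} \<in> edges (graph F) \<and> {y, z} \<in> edges (graph F)
    \<and> {x, z} \<in> edges (graph F) \<and>
      frontier X = convex hull {x, y} \<union> convex hull {y, z} \<union> convex hull {x, z}"
    using arcsI[of x y z] arcs_sym[of z x] unfolding segment_convex_hull edges_graph_iff by blast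
qed

end

section \<open>Stacking, flipping and fans\<close>

lemma arcs_Un: "arcs (S \<union> T) = arcs S \<union> arcs T"
  by (auto simp: arcs_def)

lemma arcs_rotations: "arcs (rotations (a, b, c)) = {(a, b), (b, c), (c, a)}"
  by (auto simp: arcs_def)

lemma arcs_mem: "(a, b, c) \<in> S \<Longrightarrow> (a, b) \<in> arcs S"
  by (auto simp: arcs_def)

lemma vertices_Domain: "vertices F = Domain (arcs F)"
  by (force simp: vertices_def arcs_def)

context oriented_triangulation
begin

text \<open>The surgery behind \<open>stack\<close> and \<open>flip\<close>: a patch
  \<open>S\<close> is exchanged for \<open>N\<close>, which loses the arcs \<open>I\<close> and
  gains the arcs \<open>J\<close>. As \<open>S\<close> is counterclockwise, the outer triangle is
  never touched.\<close>

lemma replace_faces: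
  assumes S: "S \<subseteq> F" "\<And>a b c. (a, b, c) \<in> S \<Longrightarrow> (b, c, a) \<in> S
    \<and> ccw a b c"
    and N: "finite N" "\<And>a b c. (a, b, c) \<in> N \<Longrightarrow> (b, c, a) \<in> N \<and> ccw a b c"
      "\<And>a b c d. (a, b, c) \<in> N \<Longrightarrow> (a, b, d) \<in> N \<Longrightarrow> c = d"
    and bd: "arcs N = arcs S - I \<union> J" "I \<subseteq> arcs S" "sym I" "sym J" "J \<inter> arcs F = {}"
  shows "oriented_triangulation (F - S \<union> N) A B C"
    and "arcs (F - S \<union> N) = arcs F - I \<union> J"
proof -
  have FS: "arcs (F - S) = arcs F - arcs S"
  proof (intro equalityI subrelI DiffI)
    fix a b assume ab: "(a, b) \<in> arcs (F - S)"
    then obtain c where c: "(a, b, c) \<in> F" "(a, b, c) \<notin> S" by (auto simp: arcs_def)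
    then show "(a, b) \<in> arcs F" by (auto simp: arcs_def)
    show "(a, b) \<notin> arcs S"
    proof
      assume "(a, b) \<in> arcs S"
      then obtain d where "(a, b, d) \<in> S" by (auto simp: arcs_def)
      then show False using c unique[of a b c d] S(1) by blast
    qed
  next
    fix a b assume "(a, b) \<in> arcs F - arcs S"
    then show "(a, b) \<in> arcs (F - S)" by (auto simp: arcs_def)
  qed
  have "arcs S \<subseteq> arcs F" using S(1) by (auto simp: arcs_def)
  then show arcs: "arcs (F - S \<union> N) = arcs F - I \<union> J"
    unfolding arcs_Un FS bd(1) using bd(2,5) by blast
  show "oriented_triangulation (F - S \<union> N) A B C"
  proof
    show "finite (F - S \<union> N)" using finite_F N(1) by simp
    show "(b, c, a) \<in> F - S \<union> N" if "(a, b, c) \<in> F - S \<union> N" for a b c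
      using that rotate[of a b c] S(2)[of b c a] S(2)[of c a b] N(2) by blast
    show "c = d" if abc: "(a, b, c) \<in> F - S \<union> N" "(a, b, d) \<in> F - S \<union> N" for a b c d
    proof -
      have disj: "(a, b) \<notin> arcs N" if "(a, b) \<in> arcs (F - S)"
        using that FS bd(1,5) by auto
      consider "(a, b, c) \<in> F - S" "(a, b, d) \<in> F - S" | "(a, b, c) \<in> N" "(a, b, d) \<in> N"
        using abc disj arcs_mem[of a b c "F - S"] arcs_mem[of a b d "F - S"]
          arcs_mem[of a b c N] arcs_mem[of a b d N] unfolding Un_iff by argo
      then show ?thesis using unique N(3) by cases blast+
    qed
    show "(b, a) \<in> arcs (F - S \<union> N)" if "(a, b) \<in> arcs (F - S \<union> N)" for a b
      using that arcs_sym[of a b] bd(3,4) unfolding arcs by (auto dest: symD)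
    have "crs A B C < 0" using ccw_outer crs_swap[of A B C] by simp
    then have "(A, B, C) \<notin> S" using S(2) by fastforce
    then show "(A, B, C) \<in> F - S \<union> N" using outer by blast
    show "ccw B A C" by (rule ccw_outer)
    show "(a, b, c) \<in> rotations (A, B, C) \<or> ccw a b c" if "(a, b, c) \<in> F - S \<union> N" for a b c
      using that ccw_inner N(2) by blast
  qed
qed

lemma stack:
  assumes f: "(a, b, c) \<in> F" and p: "ccw a b p" "ccw b c p" "ccw c a p" "p \<notin> vertices F"
  defines "G \<equiv> F - rotations (a, b, c) \<union> (rotations (a, b, p)
    \<union> rotations (b, c, p) \<union> rotations (c, a, p))"
  shows "oriented_triangulation G A B C"
    and "arcs G = arcs F \<union> ({p} \<times> {a, b, c} \<union> {a, b, c} \<times> {p})"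
    and "vertices G = insert p (vertices F)"
proof -
  let ?N = "rotations (a, b, p) \<union> rotations (b, c, p) \<union> rotations (c, a, p)"
  let ?J = "{p} \<times> {a, b, c} \<union> {a, b, c} \<times> {p}"
  \<comment> \<open>The three small areas add up to that of the face, so the face is not the outer
    one.\<close>
  have abc: "ccw a b c" using p crs_barycentric(1)[of a b p c] by simp
  have pv: "p \<noteq> a" "p \<noteq> b" "p \<noteq> c" using vertices_F[OF f] p by auto
  have 1: "rotations (a, b, c) \<subseteq> F" using f rotate[OF f] rotate'[OF f] by simp
  have 2: "(y, z, x) \<in> rotations (a, b, c)
    \<and> ccw x y z" if "(x, y, z) \<in> rotations (a, b, c)" for x y z
    using that rotations_crs[OF that] abc by auto
  have 3: "(y, z, x) \<in> ?N \<and> ccw x y z" if "(x, y, z) \<in> ?N" for x y z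
  proof -
    have "crs x y z = crs a b p \<or> crs x y z = crs b c p \<or> crs x y z = crs c a p"
      using that rotations_crs[of x y z] by blast
    then show ?thesis using that p by auto
  qed
  have 4: "z = w" if "(x, y, z) \<in> ?N" "(x, y, w) \<in> ?N" for x y z w
    using that pv ccw_distinct[OF abc] by auto
  have 5: "arcs ?N = arcs (rotations (a, b, c)) - {} \<union> ?J"
    unfolding arcs_Un arcs_rotations by auto
  have "(p, x) \<notin> arcs F" "(x, p) \<notin> arcs F" for x
    using p(4) arcs_sym[of x p] by (auto simp: vertices_Domain)
  then have 6: "?J \<inter> arcs F = {}" by auto
  have 7: "sym ?J" by (auto simp: sym_def)
  show "oriented_triangulation G A B C" and G: "arcs G = arcs F \<union> ?J"
    unfolding G_def
    using replace_faces[of "rotations (a, b, c)" ?N "{}" ?J, OF 1 2 _ 3 4 5 _ _ 7 6] by auto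
  show "vertices G = insert p (vertices F)"
    using vertices_F[OF f] unfolding vertices_Domain G by auto
qed

lemma flip:
  assumes f: "(a, b, c) \<in> F" "(b, a, d) \<in> F" "ccw a b c" "ccw b a d"
    and new: "ccw c a d" "ccw d b c" "(c, d) \<notin> arcs F"
  defines "G \<equiv> F - (rotations (a, b, c) \<union> rotations (b, a, d))
    \<union> (rotations (c, a, d) \<union> rotations (d, b, c))"
  shows "oriented_triangulation G A B C"
    and "arcs G = arcs F - {(a, b), (b, a)} \<union> {(c, d), (d, c)}"
    and "vertices G = vertices F"
proof -
  let ?S = "rotations (a, b, c) \<union> rotations (b, a, d)"
  let ?N = "rotations (c, a, d) \<union> rotations (d, b, c)"
  have 1: "?S \<subseteq> F"
    using f rotate[OF f(1)] rotate'[OF f(1)] rotate[OF f(2)] rotate'[OF f(2)] by simp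
  have 2: "(y, z, x) \<in> ?S \<and> ccw x y z" if "(x, y, z) \<in> ?S" for x y z
  proof -
    have "crs x y z = crs a b c \<or> crs x y z = crs b a d"
      using that rotations_crs[of x y z] by blast
    then show ?thesis using that f by auto
  qed
  have 3: "(y, z, x) \<in> ?N \<and> ccw x y z" if "(x, y, z) \<in> ?N" for x y z
  proof -
    have "crs x y z = crs c a d \<or> crs x y z = crs d b c"
      using that rotations_crs[of x y z] by blast
    then show ?thesis using that new by auto
  qed
  note dist = ccw_distinct[OF f(3)] ccw_distinct[OF f(4)] ccw_distinct[OF new(1)] ccw_distinct[OF new(2)]
  have 4: "z = w" if "(x, y, z) \<in> ?N" "(x, y, w) \<in> ?N" for x y z w
    using that dist by auto
  have 5: "arcs ?N = arcs ?S - {(a, b), (b, a)} \<union> {(c, d), (d, c)}"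
    unfolding arcs_Un arcs_rotations using dist by auto
  have 6: "{(c, d), (d, c)} \<inter> arcs F = {}"
    using new(3) arcs_sym[of d c] by auto
  have 7: "{(a, b), (b, a)} \<subseteq> arcs ?S"
    unfolding arcs_Un arcs_rotations by auto
  have 8: "sym {(a, b), (b, a)}" "sym {(c, d), (d, c)}"
    by (auto simp: sym_def)
  show "oriented_triangulation G A B C" and G: "arcs G = arcs F - {(a, b), (b, a)} \<union> {(c, d), (d, c)}"
    unfolding G_def
    by (rule replace_faces[OF 1 _ _ _ _ 5 7 8 6]; (erule 2 | erule 3 | erule (1) 4 | simp))+
  have kept: "(a, c) \<in> arcs F" "(b, c) \<in> arcs F" "(c, a) \<in> arcs F" "(d, b) \<in> arcs F"
    using arcsI[OF f(1)] arcsI[OF f(2)] arcs_sym by blast+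
  show "vertices G = vertices F"
  proof (intro equalityI subsetI)
    fix v assume "v \<in> vertices G"
    then show "v \<in> vertices F" using kept unfolding vertices_Domain G by blast
  next
    fix v assume "v \<in> vertices F"
    then obtain w where "(v, w) \<in> arcs F" by (auto simp: vertices_Domain)
    then have "(v, w) \<in> arcs G \<or> v = a \<or> v = b" unfolding G by blast
    moreover have "(a, c) \<in> arcs G" "(b, c) \<in> arcs G" using kept dist unfolding G by auto
    ultimately show "v \<in> vertices G" unfolding vertices_Domain by blast
  qed
qed

end

text \<open>Each flip exchanges the edge from \<open>x\<close> to the head of the list for an edge
  from \<open>v\<close> to the next entry, so the triangle at \<open>x\<close> and \<open>v\<close>
  moves along the fan. Only the last entry keeps its edge to \<open>x\<close>. The final clause
  records which triangles survive.\<close>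

lemma fan_flips:
  assumes "oriented_triangulation F A B C"
    and "(x, v, p) \<in> F" "ccw x v p"
    and "successively (\<lambda>a b. (x, a, b) \<in> F \<and> ccw x a b) (p # ps)"
    and "\<forall>q\<in>set ps. ccw x v q \<and> (v, q) \<notin> arcs F"
    and "successively (ccw v) (p # ps)" "distinct (p # ps)"
  shows "\<exists>G. oriented_triangulation G A B C \<and> (x, v, last (p # ps)) \<in> G
    \<and> successively (\<lambda>a b. (v, a, b) \<in> G) (p # ps)
    \<and> arcs G = arcs F - ({x} \<times> set (butlast (p # ps))
      \<union> set (butlast (p # ps)) \<times> {x})
        \<union> ({v} \<times> set ps \<union> set ps \<times> {v})
    \<and> (\<forall>a b c. (a, b, c) \<in> F
      \<and> (x \<notin> {a, b, c} \<or> {a, b, c} \<inter> set (butlast (p # ps)) = {})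
      \<longrightarrow> (a, b, c) \<in> G)"
  using assms
proof (induction ps arbitrary: p F)
  case Nil
  then show ?case by (intro exI[of _ F]) auto
next
  case (Cons q ps)
  interpret oriented_triangulation F A B C by fact
  have xpq: "(x, p, q) \<in> F" "ccw x p q" using Cons.prems by auto
  have xvq: "ccw x v q" "ccw v p q" "(v, q) \<notin> arcs F" using Cons.prems by auto
  define G where "G = F - (rotations (x, p, q) \<union> rotations (p, x, v))
    \<union> (rotations (q, x, v) \<union> rotations (v, p, q))"
  have pxv: "(p, x, v) \<in> F" using rotate'[OF Cons.prems(2)] .
  have "ccw p x v" "ccw q x v"
    using Cons.prems(3) xvq(1) crs_rotate[of x v p] crs_rotate[of x v q] by simp_all
  moreover have "(q, v) \<notin> arcs F" using arcs_sym[of q v] xvq by auto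
  ultimately have G: "oriented_triangulation G A B C"
    and arcsG: "arcs G = arcs F - {(x, p), (p, x)} \<union> {(q, v), (v, q)}"
    using flip[OF xpq(1) pxv xpq(2) _ _ xvq(2)] unfolding G_def by blast+
  have ne: "x \<noteq> p" "x \<noteq> q" "x \<noteq> v" "p \<noteq> v" "q \<noteq> v" "p \<noteq> q"
    using ccw_distinct[OF xvq(1)] ccw_distinct[OF xpq(2)] ccw_distinct[OF xvq(2)] by auto
  have stays: "(a, b, c) \<in> G" if "(a, b, c) \<in> F"
    "x \<notin> {a, b, c} \<or> p \<notin> {a, b, c}" for a b c
    using that by (auto simp: G_def)
  have newG: "(x, v, q) \<in> G" "(v, p, q) \<in> G" by (simp_all add: G_def)
  have "distinct (q # ps)" using Cons.prems by auto
  have qs: "successively (\<lambda>a b. (x, a, b) \<in> G \<and> ccw x a b) (q # ps)"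
  proof (rule successively_mono)
    show "successively (\<lambda>a b. (x, a, b) \<in> F \<and> ccw x a b) (q # ps)" using Cons.prems by simp
    fix a b assume "a \<in> set (q # ps)" "b \<in> set (q # ps)" and ab: "(x, a, b) \<in> F \<and> ccw x a b"
    then have "p \<noteq> a" "p \<noteq> b" using Cons.prems by auto
    then show "(x, a, b) \<in> G \<and> ccw x a b" using stays[of x a b] ab ne(1) by blast
  qed
  have "\<exists>H. oriented_triangulation H A B C \<and> (x, v, last (q # ps)) \<in> H
    \<and> successively (\<lambda>a b. (v, a, b) \<in> H) (q # ps)
    \<and> arcs H = arcs G - ({x} \<times> set (butlast (q # ps))
      \<union> set (butlast (q # ps)) \<times> {x})
        \<union> ({v} \<times> set ps \<union> set ps \<times> {v})
    \<and> (\<forall>a b c. (a, b, c) \<in> G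
      \<and> (x \<notin> {a, b, c} \<or> {a, b, c} \<inter> set (butlast (q # ps)) = {})
      \<longrightarrow> (a, b, c) \<in> H)"
  proof (rule Cons.IH[OF G _ xvq(1) qs])
    show "(x, v, q) \<in> G" by (rule newG)
    show "\<forall>r\<in>set ps. ccw x v r \<and> (v, r) \<notin> arcs G"
      using Cons.prems ne unfolding arcsG by auto
  qed (use Cons.prems in auto)
  then obtain H where H: "oriented_triangulation H A B C" "(x, v, last (q # ps)) \<in> H"
    "successively (\<lambda>a b. (v, a, b) \<in> H) (q # ps)"
    "arcs H = arcs G - ({x} \<times> set (butlast (q # ps)) \<union> set (butlast (q # ps)) \<times> {x})
        \<union> ({v} \<times> set ps \<union> set ps \<times> {v})"
    "\<forall>a b c. (a, b, c) \<in> G \<and> (x \<notin> {a, b, c} \<or> {a, b, c} \<inter> set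
      (butlast (q # ps)) = {}) \<longrightarrow> (a, b, c) \<in> H"
    by (elim exE conjE)
  show ?case
  proof (intro exI[of _ H] conjI allI impI)
    show "oriented_triangulation H A B C" by fact
    show "(x, v, last (p # q # ps)) \<in> H" using H(2) by simp
    have "(v, p, q) \<in> H" using H(5) newG(2) ne by simp
    then show "successively (\<lambda>a b. (v, a, b) \<in> H) (p # q # ps)" using H(3) by simp
    have "x \<notin> set ps" using Cons.prems(5) by auto
    then show "arcs H = arcs F - ({x} \<times> set (butlast (p # q # ps))
      \<union> set (butlast (p # q # ps)) \<times> {x})
        \<union> ({v} \<times> set (q # ps) \<union> set (q # ps) \<times> {v})"
      unfolding H(4) arcsG using ne by auto
    show "(a, b, c) \<in> H"
      if "(a, b, c) \<in> F \<and> (x \<notin> {a, b, c} \<or> {a, b, c} \<inter> set (butlast (p # q #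
        ps)) = {})" for a b c
      by (rule H(5)[rule_format]) (use that stays[of a b c] in auto)
  qed
qed

section \<open>Positions for a new vertex\<close>

lemma eventually_ray:
  fixes x d :: complex
  assumes "open U" "x \<in> U" "finite X" "d \<noteq> 0"
  shows "eventually (\<lambda>t. x + of_real t * d \<in> U - X) (at_right 0)"
proof -
  have lim: "((\<lambda>t. x + of_real t * d) \<longlongrightarrow> x) (at_right 0)"
    by (auto intro!: tendsto_eq_intros)
  have "eventually (\<lambda>t. x + of_real t * d \<noteq> y) (at_right 0)" for y
  proof (cases "x = y")
    case True
    show ?thesis
      using eventually_at_right_less[of "0::real"] by eventually_elim (use True assms(4) in auto)
  qed (use tendsto_imp_eventually_ne[OF lim] in auto)
  then have "eventually (\<lambda>t. \<forall>y\<in>X. x + of_real t * d \<noteq> y) (at_right 0)"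
    using assms(3) by (intro eventually_ball_finite) auto
  moreover have "eventually (\<lambda>t. x + of_real t * d \<in> U) (at_right 0)"
    using lim assms(1,2) by (rule topological_tendstoD)
  ultimately show ?thesis by eventually_elim auto
qed

text \<open>The point \<open>a + t * d\<close> has barycentric coordinates \<open>1 - 2 * t\<close>,
  \<open>t\<close>, \<open>t\<close>. They are positive for \<open>0 < t < 1/2\<close>, and the
  point tends to \<open>a\<close> with \<open>t\<close>.\<close>

lemma (in oriented_triangulation) stack_near:
  assumes abc: "ccw a b c" and U: "open U" "a \<in> U"
  shows "\<exists>p\<in>U. p \<notin> vertices F \<and> ccw a b p \<and> ccw b c p \<and> ccw c a p"
proof -
  define d where "d = (b - a) + (c - a)"
  have eqs: "crs a b (a + of_real t * d) = t * crs a b c"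
    "crs b c (a + of_real t * d) = (1 - 2 * t) * crs a b c"
    "crs c a (a + of_real t * d) = t * crs a b c" for t
    by (simp_all add: d_def crs_expand algebra_simps)
  have "d \<noteq> 0"
  proof
    assume "d = 0"
    with eqs(1)[of 1] abc show False by simp
  qed
  then have "eventually (\<lambda>t. a + of_real t * d \<in> U - vertices F) (at_right 0)"
    using finite_F U by (intro eventually_ray) (auto simp: vertices_def)
  moreover have "eventually (\<lambda>t. t \<in> {0<..<1/2}) (at_right (0::real))"
    by (rule eventually_at_right_real) simp
  ultimately have "eventually (\<lambda>t. a + of_real t * d \<in> U - vertices F
    \<and> t \<in> {0<..<1/2}) (at_right 0)"
    by eventually_elim simp
  then obtain t where "a + of_real t * d \<in> U - vertices F" "t \<in> {0<..<1/2}"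
    using eventually_happens'[OF trivial_limit_at_right_real] by blast
  then show ?thesis
    using abc by (intro bexI[of _ "a + of_real t * d"]) (auto simp: eqs)
qed

text \<open>Around a full turn, orientation is only cyclic; inside the half-plane of
  \<open>u\<close> it is a linear order. The identity is the linear relation between the three
  vectors from \<open>x\<close>, paired with \<open>u\<close>.\<close>

lemma ccw_trans:
  assumes "ccw x a b" "ccw x b c" "0 < u \<bullet> (a - x)" "0 < u \<bullet> (b - x)"
    "0 < u \<bullet> (c - x)"
  shows "ccw x a c"
proof -
  have "(u \<bullet> (b - x)) * crs x a c = (u \<bullet> (a - x)) * crs x b c + (u \<bullet> (c - x)) *
    crs x a b"
    by (simp add: inner_complex_def crs_expand algebra_simps)
  also have "\<dots> > 0" using assms by (intro add_pos_pos mult_pos_pos)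
  finally show ?thesis using assms(4) by (simp add: zero_less_mult_iff)
qed

lemma ccw_successively:
  assumes "successively (ccw x) (p # ps)" "\<forall>q\<in>set (p # ps). 0 < u \<bullet> (q - x)"
    "q \<in> set ps"
  shows "ccw x p q"
  using assms
proof (induction ps arbitrary: p)
  case (Cons r ps)
  show ?case
  proof (cases "q = r")
    case False
    then have "ccw x r q" using Cons by auto
    then show ?thesis using Cons.prems ccw_trans[of x p r q u] by auto
  qed (use Cons.prems in auto)
qed auto

text \<open>The new vertex \<open>v\<close> is placed next to \<open>x\<close> and takes over the
  neighbours \<open>q # butlast ps\<close> of \<open>x\<close>. The
  half-plane condition \<open>u\<close> guarantees that \<open>v\<close> can see the whole fan.\<close>

lemma fan:
  assumes F: "oriented_triangulation F A B C"
    and ps: "successively (\<lambda>a b. (x, a, b) \<in> F \<and> ccw x a b) (p # q # ps)"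
      "distinct (p # q # ps)" "ps \<noteq> []"
    and u: "\<forall>a\<in>set (p # q # ps). 0 < u \<bullet> (a - x)" and U: "open U" "x \<in> U"
  shows "\<exists>v G. oriented_triangulation G A B C \<and> v \<in> U
    \<and> v \<notin> vertices F \<and> 0 < u \<bullet> (v - x)
    \<and> (x, p, v) \<in> G \<and> ccw x p v \<and> (x, v, last ps) \<in> G \<and> ccw x v (last ps)
    \<and> successively (\<lambda>a b. (v, a, b) \<in> G \<and> ccw v a b) (p # q # ps)
    \<and> arcs G = arcs F - ({x} \<times> set (q # butlast ps) \<union> set (q # butlast ps) \<times> {x})
        \<union> ({v} \<times> insert x (set (p # q # ps)) \<union> insert x (set (p # q # ps)) \<times> {v})
    \<and> vertices G = insert v (vertices F)
    \<and> (\<forall>a b c. (a, b, c) \<in> F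
      \<and> (x \<notin> {a, b, c} \<or> {a, b, c} \<inter> set (q # butlast ps) = {}) \<longrightarrow>
      (a, b, c) \<in> G)"
proof -
  interpret oriented_triangulation F A B C by fact
  \<comment> \<open>The direction \<open>d\<close> points into the triangle \<open>x p q\<close>, so
    a short step along it stays there. \<open>V\<close> adds the open condition that the new point
    sees each pair of fan vertices with the same orientation as \<open>x\<close> does.\<close>
  define d where "d = (p - x) + (q - x)"
  define P where "P = {(a, b). a \<in> set (p # q # ps) \<and> b \<in> set (p # q # ps) \<and> ccw x a b}"
  define V where "V = U \<inter> (\<Inter>(a, b)\<in>P. {z. ccw z a b})"
  have "P \<subseteq> set (p # q # ps) \<times> set (p # q # ps)" by (auto simp: P_def)
  then have "finite P" by (rule finite_subset) simp
  moreover have "open {z. ccw z a b}" for a b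
    by (intro open_Collect_less continuous_intros)
  ultimately have V: "open V" "x \<in> V"
    unfolding V_def using U by (auto simp: P_def intro!: open_Int open_INT)
  have xpq: "(x, p, q) \<in> F" "ccw x p q" using ps by auto
  have ud: "0 < u \<bullet> d" unfolding d_def inner_add_right using u by (intro add_pos_pos) auto
  then have "d \<noteq> 0" by auto
  then have "eventually (\<lambda>t. x + of_real t * d \<in> V - vertices F) (at_right 0)"
    using finite_F V by (intro eventually_ray) (auto simp: vertices_def)
  moreover have "eventually (\<lambda>t. t \<in> {0<..<1/2}) (at_right (0::real))"
    by (rule eventually_at_right_real) simp
  ultimately have "eventually (\<lambda>t. x + of_real t * d \<in> V - vertices F
    \<and> t \<in> {0<..<1/2}) (at_right 0)"
    by eventually_elim simp
  then obtain t where t: "x + of_real t * d \<in> V - vertices F" "t \<in> {0<..<1/2}"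
    using eventually_happens'[OF trivial_limit_at_right_real] by blast
  define v where "v = x + of_real t * d"
  have v: "v \<in> V" "v \<notin> vertices F" using t by (auto simp: v_def)
  have crs_v: "crs x v a = t * (crs x p a + crs x q a)" for a
    by (simp add: v_def d_def crs_expand algebra_simps)
  have succ: "successively (ccw x) (p # q # ps)"
    using ps(1) by (rule successively_mono) auto
  then have succ': "successively (ccw x) (q # ps)" by simp
  have vr: "ccw x v a" if "a \<in> set (q # ps)" for a
  proof -
    have "ccw x p a" using ccw_successively[OF succ u that] .
    moreover have "0 \<le> crs x q a"
      using ccw_successively[OF succ', of u a] u that by (cases "a = q") auto
    ultimately show ?thesis using t(2) by (auto simp: crs_v)
  qed
  have pv: "ccw x p v"
  proof -
    have "crs x p v = t * crs x p q" by (simp add: v_def d_def crs_expand algebra_simps)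
    then show ?thesis using t(2) xpq by simp
  qed
  have succ_v: "successively (ccw v) (p # q # ps)"
    using succ
  proof (rule successively_mono)
    fix a b assume "a \<in> set (p # q # ps)" "b \<in> set (p # q # ps)" "ccw x a b"
    then have "(a, b) \<in> P" by (simp add: P_def)
    then show "ccw v a b" using v(1) by (auto simp: V_def)
  qed
  define H where "H = F - rotations (x, p, q) \<union> (rotations (x, p, v)
    \<union> rotations (p, q, v) \<union> rotations (q, x, v))"
  have "ccw p q v" "ccw q x v"
    using succ_v vr[of q] crs_rotate[of p q v] crs_rotate[of v p q] crs_rotate[of x v q] by auto
  then have H: "oriented_triangulation H A B C"
    and arcsH: "arcs H = arcs F \<union> ({v} \<times> {x, p, q} \<union> {x, p, q} \<times> {v})"
    using stack[OF xpq(1) pv _ _ v(2)] unfolding H_def by auto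
  have newH: "(x, p, v) \<in> H" "(x, v, q) \<in> H" "(v, p, q) \<in> H" by (auto simp: H_def)
  have vne: "v \<noteq> a" if "(a, b) \<in> arcs F \<or> (b, a) \<in> arcs F" for a b
    using that v(2) arcs_sym[of b a] by (auto simp: vertices_Domain)
  have ps_arcs: "(x, a) \<in> arcs F" if "a \<in> set (p # q # ps)" for a
  proof -
    have *: "(x, a) \<in> arcs F \<and> (x, b) \<in> arcs F" if "(x, a, b) \<in> F" for a b
      using arcsI[OF that] arcs_sym[of b x] by blast
    have "\<forall>a\<in>set as. (x, a) \<in> arcs F"
      if "successively (\<lambda>a b. (x, a, b) \<in> F \<and> ccw x a b) as" "length as \<ge> 2" for as
      using that
    proof (induction as)
      case (Cons a as)
      then show ?case
      proof (cases as)
        case (Cons b bs)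
        then show ?thesis using Cons.IH Cons.prems * by (cases bs) auto
      qed auto
    qed auto
    from this[OF ps(1)] show ?thesis using that by auto
  qed
  have ne: "x \<noteq> p" "x \<noteq> q" "x \<noteq> v" "p \<noteq> v" "q \<noteq> v" "p \<noteq> q"
    "v \<notin> set ps" "x \<notin> set ps" "p \<notin> set ps" "q \<notin> set ps"
    using ccw_distinct[OF pv] ccw_distinct[OF xpq(2)] vr ps(2) by force+
  have stays: "(a, b, c) \<in> H" if "(a, b, c) \<in> F"
    "x \<notin> {a, b, c} \<or> q \<notin> {a, b, c}" for a b c
    using that by (auto simp: H_def)
  have qs: "successively (\<lambda>a b. (x, a, b) \<in> H \<and> ccw x a b) (q # ps)"
  proof (rule successively_mono)
    show "successively (\<lambda>a b. (x, a, b) \<in> F \<and> ccw x a b) (q # ps)" using ps(1) by simp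
    fix a b assume "a \<in> set (q # ps)" "b \<in> set (q # ps)" and ab: "(x, a, b) \<in> F \<and> ccw x a b"
    then have "p \<noteq> a" "p \<noteq> b" using ne by auto
    then show "(x, a, b) \<in> H \<and> ccw x a b" using ab ne(1) by (auto simp: H_def)
  qed
  have "\<exists>G. oriented_triangulation G A B C \<and> (x, v, last (q # ps)) \<in> G
    \<and> successively (\<lambda>a b. (v, a, b) \<in> G) (q # ps)
    \<and> arcs G = arcs H - ({x} \<times> set (butlast (q # ps))
      \<union> set (butlast (q # ps)) \<times> {x})
        \<union> ({v} \<times> set ps \<union> set ps \<times> {v})
    \<and> (\<forall>a b c. (a, b, c) \<in> H
      \<and> (x \<notin> {a, b, c} \<or> {a, b, c} \<inter> set (butlast (q # ps)) = {})
      \<longrightarrow> (a, b, c) \<in> G)"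
  proof (rule fan_flips[OF H newH(2) _ qs])
    show "\<forall>r\<in>set ps. ccw x v r \<and> (v, r) \<notin> arcs H"
      using vr ne v(2) unfolding arcsH by (auto simp: vertices_Domain)
    show "successively (ccw v) (q # ps)" using succ_v by simp
  qed (use vr ps(2) in auto)
  then obtain G where G: "oriented_triangulation G A B C" "(x, v, last (q # ps)) \<in> G"
    "successively (\<lambda>a b. (v, a, b) \<in> G) (q # ps)"
    "arcs G = arcs H - ({x} \<times> set (butlast (q # ps)) \<union> set (butlast (q # ps)) \<times> {x})
        \<union> ({v} \<times> set ps \<union> set ps \<times> {v})"
    "\<forall>a b c. (a, b, c) \<in> H \<and> (x \<notin> {a, b, c} \<or> {a, b, c} \<inter> set
      (butlast (q # ps)) = {}) \<longrightarrow> (a, b, c) \<in> G"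
    by (elim exE conjE)
  have bl: "butlast (q # ps) = q # butlast ps" "last (q # ps) = last ps" using ps(3) by simp_all
  have bls: "set (butlast ps) \<subseteq> set ps" by (auto dest: in_set_butlastD)
  show ?thesis
  proof (intro exI[of _ v] exI[of _ G] conjI allI impI)
    show "oriented_triangulation G A B C" by fact
    show "v \<in> U" using v by (simp add: V_def)
    show "0 < u \<bullet> (v - x)" using ud t(2) by (simp add: v_def flip: scaleR_conv_of_real)
    show "(x, p, v) \<in> G"
      using G(5)[rule_format, of x p v] newH(1) ne bls unfolding bl by auto
    show "(x, v, last ps) \<in> G" using G(2) bl by simp
    show "ccw x v (last ps)" using vr[of "last ps"] ps(3) by simp
    have "(v, p, q) \<in> G" using G(5)[rule_format, of v p q] newH(3) ne by auto
    then have "successively (\<lambda>a b. (v, a, b) \<in> G) (p # q # ps)" using G(3) by simp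
    then show "successively (\<lambda>a b. (v, a, b) \<in> G \<and> ccw v a b) (p # q # ps)"
      using succ_v by (simp add: successively_conv_nth)
    show arcsG: "arcs G = arcs F - ({x} \<times> set (q # butlast ps)
      \<union> set (q # butlast ps) \<times> {x})
        \<union> ({v} \<times> insert x (set (p # q # ps)) \<union> insert x (set (p # q # ps)) \<times> {v})"
      unfolding G(4) arcsH bl using ne bls by auto
    have old: "insert x (set (p # q # ps)) \<subseteq> vertices F"
      using ps_arcs vertices_F[OF xpq(1)] arcs_sym vertices_iff by blast
    show "vertices G = insert v (vertices F)"
    proof (intro equalityI subsetI)
      fix y assume "y \<in> vertices G"
      then show "y \<in> insert v (vertices F)"
        using old unfolding vertices_Domain arcsG by auto
    next
      fix y assume y: "y \<in> insert v (vertices F)"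
      show "y \<in> vertices G"
      proof (cases "y \<in> insert v (insert x (set (p # q # ps)))")
        case True
        then show ?thesis unfolding vertices_Domain arcsG by auto
      next
        case False
        then obtain z where "(y, z) \<in> arcs F" using y by (auto simp: vertices_Domain)
        moreover have "y \<noteq> x" "y \<notin> set (q # butlast ps)" using False bls by auto
        ultimately have "(y, z) \<in> arcs G" unfolding arcsG by blast
        then show ?thesis by (auto simp: vertices_Domain)
      qed
    qed
    show "(a, b, c) \<in> G"
      if "(a, b, c) \<in> F \<and> (x \<notin> {a, b, c} \<or> {a, b, c} \<inter> set (q # butlast ps) =
        {})" for a b c
      by (rule G(5)[rule_format]) (use that stays[of a b c] in \<open>auto simp: bl\<close>)
  qed (use v pv in auto)
qed

section \<open>Colouring\<close>

definition c5_free :: "('a \<times> 'a) set \<Rightarrow> bool" where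
  "c5_free R \<longleftrightarrow> (\<forall>a b c d e. (a, b) \<in> R \<and> (b, c) \<in> R
    \<and> (c, d) \<in> R \<and> (d, e) \<in> R \<and> (e, a) \<in> R
     \<longrightarrow> \<not> distinct [a, b, c, d, e])"

lemma edges_cycle_graph_5: "edges (cycle_graph 5) = {{0, 1}, {1, 2}, {2, 3}, {3, 4}, {4, 0}}"
proof -
  have "{..<5::nat} = {0, 1, 2, 3, 4}" by auto
  then show ?thesis by (simp add: cycle_graph_def insert_commute numeral_2_eq_2)
qed

lemma copies_cycle_graph_5D:
  assumes "K \<in> copies (cycle_graph 5) G"
  obtains a b c d e where "distinct [a, b, c, d, e]" "edges K = {{a, b}, {b, c}, {c, d}, {d, e}, {e, a}}"
    "edges K \<subseteq> edges G"
proof -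
  obtain f where f: "bij_betw f {..<5} (verts K)" "edges K = (`) f ` edges (cycle_graph 5)"
    and sub: "edges K \<subseteq> edges G"
    using assms by (auto simp: copies_def isomorphic_graphs_def subgraph_def cycle_graph_def)
  have "inj_on f {..<5}" using f(1) by (rule bij_betw_imp_inj_on)
  then have inj: "f i = f j \<longleftrightarrow> i = j" if "i < 5" "j < 5" for i j
    using that by (auto simp: inj_on_def)
  show thesis
    by (rule that[of "f 0" "f 1" "f 2" "f 3" "f 4", OF _ _ sub]) (auto simp: inj f(2) edges_cycle_graph_5)
qed

lemma copies_cycle_graph_5I:
  assumes G: "simple_graph G" and d: "distinct [a, b, c, d, e]"
    and E: "{a, b} \<in> edges G" "{b, c} \<in> edges G" "{c, d} \<in> edges G" "{d, e} \<in> edges G"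
      "{e, a} \<in> edges G"
  shows "copies (cycle_graph 5) G \<noteq> {}"
proof -
  define f where "f = (\<lambda>i. [a, b, c, d, e] ! i)"
  define K where "K = \<lparr>verts = {a, b, c, d, e}, edges = {{a, b}, {b, c}, {c, d}, {d, e}, {e,
    a}}\<rparr>"
  have five: "{..<5::nat} = {0, 1, 2, 3, 4}" by auto
  have "bij_betw f {..<5} (verts K)"
    using d bij_betw_nth[of "[a, b, c, d, e]" "{..<5}" "verts K"]
    by (simp add: f_def K_def)
  moreover have "edges K = (`) f ` edges (cycle_graph 5)"
    by (simp add: edges_cycle_graph_5 K_def f_def)
  ultimately have "isomorphic_graphs (cycle_graph 5) K"
    unfolding isomorphic_graphs_def by (auto simp: cycle_graph_def)
  moreover have "subgraph K G"
    using G E d by (auto simp: subgraph_def simple_graph_def K_def)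
  ultimately show ?thesis by (auto simp: copies_def)
qed

lemma ex_rainbow_free_coloring:
  fixes F :: "(complex \<times> complex \<times> complex) set"
  assumes F: "oriented_triangulation F A B C" and W: "W \<subseteq> vertices F"
    and free: "c5_free (arcs F \<inter> W \<times> W)"
    and nbr: "\<And>v. v \<in> vertices F - W \<Longrightarrow> \<exists>w\<in>W. (v, w) \<in> arcs F"
  shows "\<exists>c. (\<forall>K\<in>copies (cycle_graph 5) (graph F). \<not> rainbow c K)
    \<and> card (arcs F \<inter> W \<times> W) + 2 * card (vertices F - W) \<le> 2 * card (c ` edges
      (graph F))"
proof -
  interpret oriented_triangulation F A B C by fact
  define S where "S = vertices F - W"
  define EW where "EW = {e \<in> edges (graph F). e \<subseteq> W}"
  have finV: "finite (vertices F)" and finE: "finite (edges (graph F))"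
    and edge_sub: "\<And>e. e \<in> edges (graph F) \<Longrightarrow> e \<subseteq> vertices F"
  proof -
    show "finite (vertices F)" using simple_graph by (auto simp: simple_graph_def)
    show *: "e \<subseteq> vertices F" if "e \<in> edges (graph F)" for e
      using simple_graph that by (auto simp: simple_graph_def)
    show "finite (edges (graph F))"
      using * \<open>finite (vertices F)\<close> finite_subset[of _ "Pow (vertices F)"] by blast
  qed
  have finS: "finite S" using finV by (simp add: S_def)
  have finEW: "finite EW" using finE by (simp add: EW_def)
  obtain rk where rk: "bij_betw rk S {0..<card S}" using ex_bij_betw_finite_nat[OF finS] by blast
  obtain col where col: "bij_betw col EW {0..<card EW}" using ex_bij_betw_finite_nat[OF finEW] by blast
  \<comment> \<open>The shift by \<open>card S\<close> keeps the colours inside \<open>W\<close>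
    apart from the ranks.\<close>
  define c where "c = (\<lambda>e. if e \<subseteq> W then card S + col e else Min (rk ` (e \<inter> S)))"
  have "{0..<card S + card EW} \<subseteq> c ` edges (graph F)"
  proof
    fix i assume i: "i \<in> {0..<card S + card EW}"
    show "i \<in> c ` edges (graph F)"
    proof (cases "i < card S")
      case True
      then obtain v where v: "v \<in> S" "rk v = i" using rk by (metis atLeast0LessThan
        bij_betw_iff_bijections lessThan_iff)
      then obtain w where w: "w \<in> W" "(v, w) \<in> arcs F" using nbr unfolding S_def by blast
      \<comment> \<open>An edge from \<open>v\<close> into \<open>W\<close> meets \<open>S\<close>
        only in \<open>v\<close>, so the rank of every vertex outside \<open>W\<close> really occurs
        as a colour.\<close>
      have "{v, w} \<inter> S = {v}" "\<not> {v, w} \<subseteq> W" using v w by (auto simp: S_def)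
      then have "c {v, w} = Min (rk ` {v})" unfolding c_def by presburger
      then have "c {v, w} = i" using v by simp
      then show ?thesis using w by (metis edges_graph_iff image_eqI)
    next
      case False
      then have "i - card S \<in> {0..<card EW}" using i by auto
      then obtain e where e: "e \<in> EW" "col e = i - card S" using col by (metis bij_betw_iff_bijections)
      then have "c e = i" "e \<in> edges (graph F)" using False by (auto simp: c_def EW_def)
      then show ?thesis by blast
    qed
  qed
  then have "card {0..<card S + card EW} \<le> card (c ` edges (graph F))"
    using finE by (intro card_mono) auto
  then have count: "card S + card EW \<le> card (c ` edges (graph F))" by simp
  have "card (arcs F \<inter> W \<times> W) \<le> 2 * card EW"
  proof -
    \<comment> \<open>\<open>pick\<close> orients each edge arbitrarily, and the swap supplies the
      other orientation. Arcs therefore count edges twice, which explains the factors 2 from here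
      on.\<close>
    define pick where "pick = (\<lambda>e. SOME p. {fst p, snd p} = (e :: complex set))"
    have "arcs F \<inter> W \<times> W \<subseteq> pick ` EW \<union> (\<lambda>e. prod.swap (pick e)) ` EW"
    proof (rule subsetI)
      fix p assume p: "p \<in> arcs F \<inter> W \<times> W"
      let ?e = "{fst p, snd p}"
      have e: "?e \<in> EW" using p by (cases p) (auto simp: EW_def)
      have "{fst (pick ?e), snd (pick ?e)} = ?e"
        unfolding pick_def by (rule someI[of "\<lambda>q. {fst q, snd q} = ?e" p]) simp
      then have "p = pick ?e \<or> p = prod.swap (pick ?e)"
        by (auto simp: doubleton_eq_iff prod_eq_iff)
      then show "p \<in> pick ` EW \<union> (\<lambda>e. prod.swap (pick e)) ` EW" using e by blast
    qed
    then have "card (arcs F \<inter> W \<times> W) \<le> card (pick ` EW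
      \<union> (\<lambda>e. prod.swap (pick e)) ` EW)"
      using finEW by (intro card_mono) auto
    also have "\<dots> \<le> card (pick ` EW) + card ((\<lambda>e. prod.swap (pick e)) ` EW)"
      by (rule card_Un_le)
    also have "\<dots> \<le> card EW + card EW"
      by (intro add_mono card_image_le finEW)
    finally show ?thesis by simp
  qed
  then have "card (arcs F \<inter> W \<times> W) + 2 * card (vertices F - W) \<le> 2 * card (c ` edges
    (graph F))"
    using count by (simp add: S_def)
  moreover have "\<not> rainbow c K" if K: "K \<in> copies (cycle_graph 5) (graph F)" for K
  proof
    assume rb: "rainbow c K"
    obtain x0 x1 x2 x3 x4 where x: "distinct [x0, x1, x2, x3, x4]"
      "edges K = {{x0, x1}, {x1, x2}, {x2, x3}, {x3, x4}, {x4, x0}}" "edges K \<subseteq> edges (graph F)"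
      using copies_cycle_graph_5D[OF K] .
    let ?X = "{x0, x1, x2, x3, x4}"
    have arcs: "(x0, x1) \<in> arcs F" "(x1, x2) \<in> arcs F" "(x2, x3) \<in> arcs F"
      "(x3, x4) \<in> arcs F" "(x4, x0) \<in> arcs F"
      using x(2,3) by simp_all
    have XV: "?X \<subseteq> vertices F" using arcs vertices_iff by blast
    show False
    proof (cases "?X \<subseteq> W")
      case True
      then show False using free arcs x(1) unfolding c5_free_def by blast
    next
      case False
      then have "?X \<inter> S \<noteq> {}" using XV by (auto simp: S_def)
      then obtain v where v: "v \<in> ?X \<inter> S"
        "\<And>y. y \<in> ?X \<inter> S \<Longrightarrow> rk v \<le> rk y"
        using ex_min_if_finite[of "rk ` (?X \<inter> S)"] by (auto simp: not_less)
      have cv: "c {v, y} = rk v" if "y \<in> ?X" for y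
      proof -
        have "\<not> {v, y} \<subseteq> W" using v by (auto simp: S_def)
        moreover have "Min (rk ` ({v, y} \<inter> S)) = rk v"
          by (rule Min_eqI) (use v that in auto)
        ultimately show ?thesis unfolding c_def by presburger
      qed
      have bad: False if "{v, y} \<in> edges K" "{v, z} \<in> edges K" "y \<in> ?X" "z \<in> ?X"
        "y \<noteq> z" for y z
      proof -
        have "c {v, y} = c {v, z}" using cv that by simp
        then have "{v, y} = {v, z}" using rb that unfolding rainbow_def inj_on_def by blast
        then show False using that(5) by (auto simp: doubleton_eq_iff)
      qed
      have "v = x0 \<or> v = x1 \<or> v = x2 \<or> v = x3 \<or> v = x4" using v by auto
      then show False
      proof (elim disjE)
        assume "v = x0" then show False using bad[of x1 x4] x(1,2) by (auto simp: insert_commute)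
      next
        assume "v = x1" then show False using bad[of x0 x2] x(1,2) by (auto simp: insert_commute)
      next
        assume "v = x2" then show False using bad[of x1 x3] x(1,2) by (auto simp: insert_commute)
      next
        assume "v = x3" then show False using bad[of x2 x4] x(1,2) by (auto simp: insert_commute)
      next
        assume "v = x4" then show False using bad[of x3 x0] x(1,2) by (auto simp: insert_commute)
      qed
    qed
  qed
  ultimately show ?thesis by blast
qed

lemma planar_anti_ramsey_cycle_5_ge:
  fixes F :: "(complex \<times> complex \<times> complex) set"
  assumes F: "oriented_triangulation F A B C" and W: "W \<subseteq> vertices F"
    and free: "c5_free (arcs F \<inter> W \<times> W)"
    and nbr: "\<And>v. v \<in> vertices F - W \<Longrightarrow> \<exists>w\<in>W. (v, w) \<in> arcs F"
    and cyc: "\<not> c5_free (arcs F)"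
  shows "card (arcs F \<inter> W \<times> W) + 2 * card (vertices F - W)
    \<le> 2 * planar_anti_ramsey (card (vertices F)) (cycle_graph 5)"
proof -
  interpret oriented_triangulation F A B C by fact
  obtain c where c: "\<forall>K\<in>copies (cycle_graph 5) (graph F). \<not> rainbow c K"
    "card (arcs F \<inter> W \<times> W) + 2 * card (vertices F - W) \<le> 2 * card (c ` edges (graph F))"
    using ex_rainbow_free_coloring[OF F W free nbr] by blast
  have "copies (cycle_graph 5) (graph F) \<noteq> {}"
  proof -
    obtain a b c d e where "distinct [a, b, c, d, e]" "(a, b) \<in> arcs F" "(b, c) \<in> arcs F"
      "(c, d) \<in> arcs F" "(d, e) \<in> arcs F" "(e, a) \<in> arcs F"
      using cyc unfolding c5_free_def by blast
    then show ?thesis by (intro copies_cycle_graph_5I[OF simple_graph]) auto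
  qed
  then have "(graph F, \<lambda>e. convex hull e) \<in> triangulations_containing (card (vertices F))
    (cycle_graph 5)"
    using plane_triangulation by (auto simp: triangulations_containing_def)
  then have "card (c ` edges (graph F)) \<in> rainbow_free_color_counts (card (vertices F)) (cycle_graph 5)"
    using c(1) unfolding rainbow_free_color_counts_def by blast
  then have "card (c ` edges (graph F)) \<le> planar_anti_ramsey (card (vertices F)) (cycle_graph 5)"
    unfolding planar_anti_ramsey_def by (intro Max_ge finite_rainbow_free_color_counts)
  with c(2) show ?thesis by linarith
qed

section \<open>Attaching copies of the complete graph on four vertices\<close>

definition clique :: "'a set \<Rightarrow> ('a \<times> 'a) set" where
  "clique S = {(a, b). a \<in> S \<and> b \<in> S \<and> a \<noteq> b}"

text \<open>\<open>far2\<close>, \<open>far3\<close> and \<open>far4\<close> say that the distance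
  in the graph \<open>R\<close> is at least 2, 3 and 4, unrolled so that no paths are
  needed.\<close>

definition far2 :: "('a \<times> 'a) set \<Rightarrow> 'a \<Rightarrow> 'a \<Rightarrow> bool" where
  "far2 R a b \<longleftrightarrow> a \<noteq> b \<and> (a, b) \<notin> R"

definition far3 :: "('a \<times> 'a) set \<Rightarrow> 'a \<Rightarrow> 'a \<Rightarrow> bool" where
  "far3 R a b \<longleftrightarrow> far2 R a b
    \<and> (\<forall>u. (a, u) \<in> R \<longrightarrow> far2 R u b)"

definition far4 :: "('a \<times> 'a) set \<Rightarrow> 'a \<Rightarrow> 'a \<Rightarrow> bool" where
  "far4 R a b \<longleftrightarrow> far3 R a b
    \<and> (\<forall>u. (a, u) \<in> R \<longrightarrow> far3 R u b)"

lemma far2_sym: "sym R \<Longrightarrow> far2 R a b \<Longrightarrow> far2 R b a"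
  by (auto simp: far2_def dest: symD)

lemma far3_sym: "sym R \<Longrightarrow> far3 R a b \<Longrightarrow> far3 R b a"
  unfolding far3_def by (auto simp: far2_def dest: symD)

text \<open>The two copies join \<open>p\<close> and \<open>q\<close> by a path of length 2 through
  \<open>l\<close>. As \<open>p\<close> and \<open>q\<close> were at distance at least 4, a cycle
  running through both copies has length at least 6. The other claims supply distances for the next
  prolongation: for example, \<open>h\<close> reaches an old \<open>x\<close> only through
  \<open>q\<close>, or through \<open>l\<close> and \<open>p\<close>.\<close>

lemma two_cliques:
  assumes R: "R \<subseteq> D \<times> D" "sym R" "c5_free R"
    and old: "p \<in> D" "q \<in> D"
    and new: "distinct [l, g, c, h, d]" "{l, g, c, h, d} \<inter> D = {}"
    and far: "far4 R p q"
  defines "R' \<equiv> R \<union> clique {p, l, g, c} \<union> clique {q, l, h, d}"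
  shows "c5_free R'"
    and "far2 R' g h"
    and "x \<in> D \<Longrightarrow> far2 R p x \<Longrightarrow> far2 R q x \<Longrightarrow> far3 R' g x"
    and "x \<in> D \<Longrightarrow> far2 R p x \<Longrightarrow> far3 R q x \<Longrightarrow> far4 R' h x"
proof -
  have pq: "p \<noteq> q" using far by (auto simp: far4_def far3_def far2_def)
  have ne: "l \<noteq> g" "l \<noteq> c" "l \<noteq> h" "l \<noteq> d" "g \<noteq> c" "g \<noteq> h"
    "g \<noteq> d" "c \<noteq> h" "c \<noteq> d" "h \<noteq> d"
    "l \<noteq> p" "l \<noteq> q" "g \<noteq> p" "g \<noteq> q" "c \<noteq> p" "c \<noteq> q"
      "h \<noteq> p" "h \<noteq> q" "d \<noteq> p" "d \<noteq> q"
    using new old by auto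
  have R_new: "(x, y) \<notin> R" "(y, x) \<notin> R" if "x \<in> {l, g, c, h, d}" for x y
    using that new(2) R(1) by auto
  have sym': "(y, x) \<in> R'" if "(x, y) \<in> R'" for x y
    using that R(2) by (auto simp: R'_def clique_def dest: symD)
  have N: "(g, y) \<in> R' \<longleftrightarrow> y = p \<or> y = l \<or> y = c"
    "(c, y) \<in> R' \<longleftrightarrow> y = p \<or> y = l \<or> y = g"
    "(h, y) \<in> R' \<longleftrightarrow> y = q \<or> y = l \<or> y = d"
      "(d, y) \<in> R' \<longleftrightarrow> y = q \<or> y = l \<or> y = h"
    "(l, y) \<in> R' \<longleftrightarrow> y = p \<or> y = g \<or> y = c \<or> y = q \<or> y = h \<or> y
      = d" for y
    using ne R_new by (auto simp: R'_def clique_def)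
  have N': "(y, x) \<in> R' \<longleftrightarrow> (x, y) \<in> R'" if "x \<in> {l, g, c, h, d}" for x y
    using sym' by blast
  have N_old: "(x, y) \<in> R' \<longleftrightarrow> (x, y) \<in> R \<or> (x = p
    \<and> y \<in> {l, g, c}) \<or> (x = q \<and> y \<in> {l, h, d})"
    if "x \<in> D" for x y
    using that ne new(2) pq by (auto simp: R'_def clique_def)
  have notD: "l \<notin> D" "g \<notin> D" "c \<notin> D" "h \<notin> D" "d \<notin> D" using new by auto
  have old_new: "x \<in> {l, g, c, h, d}" if "(x, y) \<in> R'" "x \<notin> D" for x y
    using that R(1) old by (auto simp: R'_def clique_def)
  \<comment> \<open>Both \<open>b\<close> and \<open>e\<close> lie in copies at \<open>l\<close>,
    which forces \<open>u\<close> and \<open>v\<close> to be old. What remains is a repeated vertex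
    or a path of length at most 3 from \<open>p\<close> to \<open>q\<close> in
    \<open>R\<close>.\<close>
  have no_l: "False" if "(l, b) \<in> R'" "(b, u) \<in> R'" "(u, v) \<in> R'" "(v, e) \<in> R'"
    "(e, l) \<in> R'"
    and dis: "distinct [l, b, u, v, e]" for b u v e
  proof -
    have side: "(b = p \<or> b = g \<or> b = c)
      \<and> (e = p \<or> e = g \<or> e = c) \<or> (b = p \<or> b = g \<or> b = c)
      \<and> (e = q \<or> e = h \<or> e = d)
      \<or> (b = q \<or> b = h \<or> b = d)
        \<and> (e = p \<or> e = g \<or> e = c) \<or> (b = q \<or> b = h \<or> b = d)
        \<and> (e = q \<or> e = h \<or> e = d)"
      using that(1,5) N N'[of l e] by auto
    have no: "(p, q) \<notin> R" "(q, p) \<notin> R"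
      "\<And>x. (p, x) \<in> R \<Longrightarrow> (x, q) \<in> R \<Longrightarrow> False"
        "\<And>x. (q, x) \<in> R \<Longrightarrow> (x, p) \<in> R \<Longrightarrow> False"
      "\<And>x y. (p, x) \<in> R \<Longrightarrow> (x, y) \<in> R \<Longrightarrow> (y, q) \<in> R
        \<Longrightarrow> False"
      "\<And>x y. (q, x) \<in> R \<Longrightarrow> (x, y) \<in> R \<Longrightarrow> (y, p) \<in> R
        \<Longrightarrow> False"
      using far R(2) unfolding far4_def far3_def far2_def sym_def by blast+
    have b: "b = p \<or> b = g \<or> b = c \<or> b = q \<or> b = h \<or> b = d"
      and e: "e = p \<or> e = g \<or> e = c \<or> e = q \<or> e = h \<or> e = d" using side by blast+
    have rev: "(u, b) \<in> R'" "(v, u) \<in> R'" "(e, v) \<in> R'" using sym' that by auto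
    note Np = N_old[OF old(1)] and Nq = N_old[OF old(2)]
    have u: "u \<in> D"
    proof (rule ccontr)
      assume "u \<notin> D"
      then have "u = g \<or> u = c \<or> u = h \<or> u = d" using old_new[OF rev(1)] dis by auto
      then show False
        using that(2-4) rev e dis ne pq no(1,2) by (elim disjE) (auto simp: N Np Nq)
    qed
    have v: "v \<in> D"
    proof (rule ccontr)
      assume "v \<notin> D"
      then have "v = g \<or> v = c \<or> v = h \<or> v = d" using old_new[OF rev(2)] dis by auto
      then show False
        using that(2-4) rev b dis ne pq no(1,2) by (elim disjE) (auto simp: N Np Nq)
    qed
    have uv: "(u, v) \<in> R" using that(3) N_old[OF u] v notD by auto
    have nD: "u \<noteq> g" "u \<noteq> c" "u \<noteq> h" "u \<noteq> d" "v \<noteq> g" "v \<noteq> c"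
      "v \<noteq> h" "v \<noteq> d" "u \<noteq> l" "v \<noteq> l"
      using u v notD by auto
    have bu: "b = p \<and> (p, u) \<in> R \<or> b = q
      \<and> (q, u) \<in> R \<or> (b = g \<or> b = c) \<and> u = p \<or> (b = h \<or> b = d) \<and> u = q"
      using b that(2) nD by (elim disjE) (auto simp: N Np Nq)
    have ev: "e = p \<and> (v, p) \<in> R \<or> e = q
      \<and> (v, q) \<in> R \<or> (e = g \<or> e = c) \<and> v = p \<or> (e = h \<or> e = d) \<and> v = q"
      using e rev(3) nD R(2) by (elim disjE) (simp_all add: N Np Nq sym_def)
    show False
      using bu ev uv dis pq no ne by (elim disjE conjE) auto
  qed
  show "far2 R' g h" using ne by (auto simp: far2_def N)
  show "far3 R' g x" if "x \<in> D" "far2 R p x" "far2 R q x"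
    using that ne notD old N_old[OF old(1), of x] by (auto simp: far3_def far2_def N)
  show "far4 R' h x" if "x \<in> D" "far2 R p x" "far3 R q x"
  proof -
    have x: "x \<noteq> p" "x \<noteq> q" "(p, x) \<notin> R" "(q, x) \<notin> R"
      "\<And>u. (q, u) \<in> R \<Longrightarrow> (u, x) \<notin> R \<and> u \<noteq> x"
      using that by (auto simp: far3_def far2_def)
    have xx: "x \<noteq> l" "x \<noteq> g" "x \<noteq> c" "x \<noteq> h"
      "x \<noteq> d" using that notD by auto
    have old_x: "(u, x) \<in> R' \<longleftrightarrow> (u, x) \<in> R" for u
      using xx x by (auto simp: R'_def clique_def)
    have "far2 R' u x" if "u \<in> {p, q, l, g, c, h, d}" for u
      using that x xx old_x R_new by (auto simp: far2_def)
    moreover have "far2 R' u x" if "(q, u) \<in> R" for u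
      using x(5)[OF that] by (auto simp: far2_def old_x)
    ultimately have "far3 R' u x" if "u \<in> {q, l, h, d}" for u
      using that N_old[OF old(2)] by (auto simp: far3_def N)
    then show ?thesis by (auto simp: far4_def N)
  qed
  show "c5_free R'"
    unfolding c5_free_def
  proof (intro allI impI notI)
    fix v0 v1 v2 v3 v4
    assume E: "(v0, v1) \<in> R' \<and> (v1, v2) \<in> R' \<and> (v2, v3) \<in> R'
      \<and> (v3, v4) \<in> R' \<and> (v4, v0) \<in> R'"
      and dis: "distinct [v0, v1, v2, v3, v4]"
    have nl: "v0 \<noteq> l" "v1 \<noteq> l" "v2 \<noteq> l" "v3 \<noteq> l" "v4 \<noteq> l"
      using no_l[of v1 v2 v3 v4] no_l[of v2 v3 v4 v0] no_l[of v3 v4 v0 v1] no_l[of v4 v0 v1 v2]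
        no_l[of v0 v1 v2 v3] E dis by auto
    \<comment> \<open>Without \<open>l\<close>, each of \<open>g\<close>, \<open>c\<close>,
      \<open>h\<close>, \<open>d\<close> has just two neighbours, joined to each other, and one of
      these has no further neighbour by which the cycle could go on.\<close>
    have no_new: "y \<in> D" if "(x, y) \<in> R'" "(y, z) \<in> R'" "(z, w) \<in> R'" "distinct [x, y, z, w]"
      "(v, x) \<in> R'" "v \<noteq> y" "v \<noteq> z" "l \<notin> {v, x, y, z, w}" for v x y z w
    proof (rule ccontr)
      assume "y \<notin> D"
      then have "y \<in> {g, c, h, d}" using old_new that by blast
      moreover have "(y, x) \<in> R'" "(x, v) \<in> R'" using sym' that by auto
      ultimately show False using that ne by (auto simp: N)
    qed
    have "v0 \<in> D" "v1 \<in> D" "v2 \<in> D" "v3 \<in> D" "v4 \<in> D"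
      using no_new[of v4 v0 v1 v2 v3] no_new[of v0 v1 v2 v3 v4] no_new[of v1 v2 v3 v4 v0]
        no_new[of v2 v3 v4 v0 v1] no_new[of v3 v4 v0 v1 v2] E dis nl by auto
    then have "(v0, v1) \<in> R \<and> (v1, v2) \<in> R \<and> (v2, v3) \<in> R
      \<and> (v3, v4) \<in> R \<and> (v4, v0) \<in> R"
      using E N_old new(2) by auto
    then show False using R(3) dis unfolding c5_free_def by blast
  qed
qed

section \<open>Growing the tube\<close>

lemma clique_4: "distinct [a, b, c, d] \<Longrightarrow> clique {a, b, c, d} =
  {(a, b), (a, c), (a, d), (b, a), (b, c), (b, d), (c, a), (c, b), (c, d), (d, a), (d, b), (d, c)}"
  by (auto simp: clique_def)

text \<open>The end of the tube under construction: \<open>0\<close> is the vertex in the open end, and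
  the listed vertices
  are its neighbours in cyclic order. Of these, \<open>p\<close>, \<open>last rs\<close> and
    \<open>x\<close> lie in only one copy of the
  complete graph on four vertices so far. The next step attaches new copies at \<open>p\<close> and
    \<open>last rs\<close>; the
  distance conditions prevent them from closing a cycle of length five. The vectors \<open>u1\<close>,
    \<open>u2\<close>, \<open>u3\<close>
  witness that the three sectors cut out by \<open>p\<close>, \<open>last rs\<close> and
    \<open>x\<close> are smaller than a half-plane.\<close>

locale hub = oriented_triangulation F A B C
  for F :: "(complex \<times> complex \<times> complex) set" and A B C +
  fixes W :: "complex set" and p q :: complex and rs :: "complex list" and w5 w6 x w8 u1 u2 u3 :: complex
  assumes star: "successively (\<lambda>a b. (0, a, b) \<in> F
    \<and> ccw 0 a b) (p # q # rs @ [w5, w6, x, w8, p])"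
    and dist: "distinct (p # q # rs @ [w5, w6, x, w8])"
    and rs: "rs \<noteq> []"
    and W: "W \<subseteq> vertices F" "0 \<notin> W" "p \<in> W" "last rs \<in> W" "x \<in> W"
    and u1: "\<And>a. a \<in> set (p # q # rs) \<Longrightarrow> 0 < u1 \<bullet> a"
    and u2: "\<And>a. a \<in> {last rs, w5, w6, x} \<Longrightarrow> 0 < u2 \<bullet> a"
    and u3: "\<And>a. a \<in> {x, w8, p} \<Longrightarrow> 0 < u3 \<bullet> a"
    and free: "c5_free (arcs F \<inter> W \<times> W)"
    and far: "far4 (arcs F \<inter> W \<times> W) p (last rs)" "far2 (arcs F \<inter> W \<times> W) p x"
      "far3 (arcs F \<inter> W \<times> W) (last rs) x"
    and nbr: "\<And>v. v \<in> vertices F - W \<Longrightarrow> \<exists>w\<in>W. (v, w) \<in> arcs F"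

lemma (in oriented_triangulation) star_vertices:
  assumes "successively (\<lambda>a b. (y, a, b) \<in> F \<and> ccw y a b) as" "2 \<le> length as"
  shows "set as \<subseteq> vertices F"
  using assms
proof (induction as)
  case (Cons a as)
  then show ?case
  proof (cases as)
    case (Cons b bs)
    then show ?thesis using Cons.IH Cons.prems vertices_F[of y a b] by (cases bs) auto
  qed auto
qed auto

text \<open>Two fans and four insertions. The first fan puts \<open>l\<close> between
  \<open>0\<close> and the sector from \<open>p\<close> to \<open>last rs\<close>; the second puts
  \<open>s\<close> between \<open>l\<close> and that sector, so that \<open>s\<close> is the vertex
  inside the cell now closed off. Then \<open>g\<close> and \<open>h\<close> go into the triangles
  that \<open>0\<close> and \<open>l\<close> form with \<open>p\<close> and \<open>last rs\<close>.
  They complete the outlines of two copies, whose centres are \<open>c\<close> and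
  \<open>d\<close>.\<close>

lemma (in hub) insert_hub:
  "\<exists>G l s g h c d. oriented_triangulation G A B C
    \<and> distinct [l, s, g, h, c, d] \<and> {l, s, g, h, c, d} \<inter> vertices F = {}
    \<and> vertices G = vertices F \<union> {l, s, g, h, c, d}
    \<and> successively (\<lambda>a b. (0, a, b) \<in> G
      \<and> ccw 0 a b) (h # last rs # [w5, w6, x] @ [w8, p, g, l, h])
    \<and> 0 < u2 \<bullet> h \<and> 0 < u3 \<bullet> g \<and> 0 < u1 \<bullet> g
      \<and> 0 < u1 \<bullet> l \<and> 0 < u1 \<bullet> h
    \<and> arcs G = arcs F - ({0} \<times> set (q # butlast rs) \<union> set (q # butlast rs) \<times> {0})
      \<union> ({l, s} \<times> {p, last rs} \<union> {p, last rs} \<times> {l, s})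
      \<union> ({s} \<times> insert l (set (q # butlast rs))
        \<union> insert l (set (q # butlast rs)) \<times> {s})
      \<union> ({0} \<times> {l, g, h} \<union> {l, g, h} \<times> {0})
      \<union> ({g, c} \<times> {p, l} \<union> {p, l} \<times> {g, c} \<union> {(g, c), (c, g)})
      \<union> ({h, d} \<times> {last rs, l} \<union> {last rs, l} \<times> {h, d} \<union> {(h, d), (d, h)})"
proof -
  define z where "z = last rs"
  define M where "M = set (q # butlast rs)"
  have rs_eq: "rs = butlast rs @ [z]" using rs by (simp add: z_def)
  have P: "set (p # q # rs) = insert p (insert z M)"
    by (subst rs_eq) (auto simp: M_def)
  have dist': "distinct (p # q # butlast rs @ [z, w5, w6, x, w8])"
    using dist by (subst (asm) rs_eq) auto
  then have M_out: "p \<notin> M" "z \<notin> M" "w5 \<notin> M" "w6 \<notin> M" "x \<notin> M"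
    "w8 \<notin> M"
    by (auto simp: M_def)
  have star': "successively (\<lambda>a b. (0, a, b) \<in> F \<and> ccw 0 a b) (p # q # rs)"
  proof -
    have "successively (\<lambda>a b. (0, a, b) \<in> F \<and> ccw 0 a b) ((p # q # rs) @ [w5, w6, x, w8, p])"
      using star by simp
    then show ?thesis unfolding successively_append_iff by blast
  qed
  have "successively (\<lambda>a b. (0, a, b) \<in> F
    \<and> ccw 0 a b) ((p # q # butlast rs) @ [z, w5, w6, x, w8, p])"
    using star by (subst (asm) rs_eq) simp
  then have star2: "successively (\<lambda>a b. (0, a, b) \<in> F \<and> ccw 0 a b) [z, w5, w6, x, w8, p]"
    unfolding successively_append_iff by blast
  \<comment> \<open>The second fan is centred at \<open>l\<close>, so the whole sector must also lie
    in the half-plane \<open>u1\<close> as seen from \<open>l\<close>. This is an open condition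
    that holds at \<open>0\<close>.\<close>
  let ?U = "{y. \<forall>a\<in>set (p # q # rs). 0 < u1 \<bullet> (a - y)}"
  have "?U = (\<Inter>a\<in>set (p # q # rs). {y. 0 < u1 \<bullet> (a - y)})" by auto
  also have "open \<dots>"
    by (intro open_INT finite_set ballI open_Collect_less continuous_intros)
  finally have "open ?U" .
  moreover have "0 \<in> ?U" using u1 by auto
  ultimately obtain l G1 where l: "l \<in> ?U" "l \<notin> vertices F" "0 < u1 \<bullet> l"
    and G1: "oriented_triangulation G1 A B C" "(0, p, l) \<in> G1" "ccw 0 p l" "(0, l, z) \<in> G1"
      "ccw 0 l z"
      "successively (\<lambda>a b. (l, a, b) \<in> G1 \<and> ccw l a b) (p # q # rs)"
      "arcs G1 = arcs F - ({0} \<times> M \<union> M \<times> {0})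
        \<union> ({l} \<times> insert 0 (set (p # q # rs)) \<union> insert 0 (set (p # q # rs)) \<times> {l})"
      "vertices G1 = insert l (vertices F)"
      "\<forall>a b c. (a, b, c) \<in> F
        \<and> (0 \<notin> {a, b, c} \<or> {a, b, c} \<inter> M = {}) \<longrightarrow> (a, b, c) \<in> G1"
    using fan[OF oriented_triangulation_axioms star' _ rs, of u1 ?U] u1 dist
    unfolding M_def z_def by auto
  have "\<forall>a\<in>set (p # q # rs). 0 < u1 \<bullet> (a - l)" using l(1) by simp
  then obtain s G2 where s: "s \<notin> vertices G1"
    and G2: "oriented_triangulation G2 A B C"
      "arcs G2 = arcs G1 - ({l} \<times> M \<union> M \<times> {l})
        \<union> ({s} \<times> insert l (set (p # q # rs)) \<union> insert l (set (p # q # rs)) \<times> {s})"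
      "vertices G2 = insert s (vertices G1)"
      "\<forall>a b c. (a, b, c) \<in> G1
        \<and> (l \<notin> {a, b, c} \<or> {a, b, c} \<inter> M = {}) \<longrightarrow> (a, b, c) \<in> G2"
    using fan[OF G1(1) G1(6) _ rs, of u1 UNIV] dist
    unfolding M_def by auto
  have zero: "0 \<in> vertices F" "p \<in> vertices F" "z \<in> vertices F"
    using star vertices_F[of 0 p q] W by (auto simp: z_def)
  have old: "M \<subseteq> vertices F"
    using star_vertices[OF star'] unfolding P by simp
  have M0: "0 \<notin> M" using u1[of 0] unfolding P by auto
  have ne0: "l \<noteq> 0" "l \<noteq> p" "l \<noteq> z" "s \<noteq> l" "s \<noteq> 0" "s \<noteq> p"
    "s \<noteq> z" "p \<noteq> 0" "z \<noteq> 0" "p \<noteq> z" "l \<notin> M"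
    using ccw_distinct[OF G1(3)] ccw_distinct[OF G1(5)] zero s G1(8) dist' l(2) old(1) by auto
  have keep: "(a, b, c) \<in> G2" if "(a, b, c) \<in> F" "{a, b, c} \<inter> M = {}" for a b c
    using that G1(9) G2(4) by blast
  have lG2: "(0, p, l) \<in> G2" "(0, l, z) \<in> G2"
    using G2(4) G1(2,4) M0 M_out ne0 by auto
  interpret g2: oriented_triangulation G2 A B C by fact
  have plO: "(p, l, 0) \<in> G2" "ccw p l 0" "(z, 0, l) \<in> G2" "ccw z 0 l"
    using g2.rotate[OF lG2(1)] g2.rotate'[OF lG2(2)] G1(3,5) crs_rotate[of p l 0] crs_rotate[of 0 l z]
    by simp_all
  \<comment> \<open>\<open>p\<close> belongs to the sectors of \<open>u1\<close> and
    \<open>u3\<close>, hence so does \<open>g\<close> when chosen near \<open>p\<close>; in the next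
    hub \<open>g\<close> is the border between these sectors. Likewise \<open>h\<close> is chosen
    near \<open>z\<close>, in the sectors of \<open>u1\<close> and \<open>u2\<close>.\<close>
  have "open {y. 0 < u3 \<bullet> y \<and> 0 < u1 \<bullet> y}"
    by (intro open_Collect_conj open_Collect_less continuous_intros)
  then obtain g where g: "0 < u3 \<bullet> g" "0 < u1 \<bullet> g" "g \<notin> vertices G2" "ccw p l g"
    "ccw l 0 g" "ccw 0 p g"
    using g2.stack_near[OF plO(2), of "{y. 0 < u3 \<bullet> y \<and> 0 < u1 \<bullet> y}"] u1 u3 by auto
  define G3 where "G3 = G2 - rotations (p, l, 0) \<union> (rotations (p, l, g)
    \<union> rotations (l, 0, g) \<union> rotations (0, p, g))"
  note G3 = g2.stack[OF plO(1) g(4,5,6,3), folded G3_def]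
  interpret g3: oriented_triangulation G3 A B C by (rule G3(1))
  have zG3: "(z, 0, l) \<in> G3" using plO(3) ne0 by (auto simp: G3_def)
  have "open {y. 0 < u2 \<bullet> y \<and> 0 < u1 \<bullet> y}"
    by (intro open_Collect_conj open_Collect_less continuous_intros)
  moreover have "z \<in> {y. 0 < u2 \<bullet> y
    \<and> 0 < u1 \<bullet> y}" using u1[of z] u2[of z] P by (auto simp: z_def)
  ultimately obtain h where h: "0 < u2 \<bullet> h" "0 < u1 \<bullet> h" "h \<notin> vertices G3"
    "ccw z 0 h" "ccw 0 l h" "ccw l z h"
    using g3.stack_near[OF plO(4), of "{y. 0 < u2 \<bullet> y \<and> 0 < u1 \<bullet> y}"] by auto
  define G4 where "G4 = G3 - rotations (z, 0, l) \<union> (rotations (z, 0, h)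
    \<union> rotations (0, l, h) \<union> rotations (l, z, h))"
  note G4 = g3.stack[OF zG3 h(4,5,6,3), folded G4_def]
  interpret g4: oriented_triangulation G4 A B C by (rule G4(1))
  have gG4: "(p, l, g) \<in> G4" using ne0 by (auto simp: G4_def G3_def)
  obtain c where c: "c \<notin> vertices G4" "ccw p l c" "ccw l g c" "ccw g p c"
    using g4.stack_near[OF g(4), of UNIV] by auto
  define G5 where "G5 = G4 - rotations (p, l, g) \<union> (rotations (p, l, c)
    \<union> rotations (l, g, c) \<union> rotations (g, p, c))"
  note G5 = g4.stack[OF gG4 c(2,3,4,1), folded G5_def]
  interpret g5: oriented_triangulation G5 A B C by (rule G5(1))
  have "z \<noteq> g" using g(3) zero unfolding G2(3) G1(8) by auto
  then have hG5: "(l, z, h) \<in> G5" using ne0 g(4) by (auto simp: G5_def G4_def)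
  obtain d where d: "d \<notin> vertices G5" "ccw l z d" "ccw z h d" "ccw h l d"
    using g5.stack_near[OF h(6), of UNIV] by auto
  define G6 where "G6 = G5 - rotations (l, z, h) \<union> (rotations (l, z, d)
    \<union> rotations (z, h, d) \<union> rotations (h, l, d))"
  note G6 = g5.stack[OF hG5 d(2,3,4,1), folded G6_def]
  note fresh = l(2) s g(3) h(3) c(1) d(1)
  note verts = G1(8) G2(3) G3(3) G4(3) G5(3) G6(3)
  have new: "distinct [l, s, g, h, c, d]" "{l, s, g, h, c, d} \<inter> vertices F = {}"
    using fresh unfolding verts by auto
  have ne: "g \<noteq> 0" "h \<noteq> 0" "c \<noteq> 0" "d \<noteq> 0" using new zero by auto
  have keep6: "(0, a, b) \<in> G6" if "(0, a, b) \<in> F" "a \<notin> M" "b \<notin> M" for a b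
  proof -
    have ab: "a \<in> vertices F" "b \<in> vertices F" using vertices_F[OF that(1)] by auto
    then have "l \<noteq> a" "l \<noteq> b" using l(2) by auto
    moreover have "(0, a, b) \<in> G2" using that keep M0 by auto
    ultimately show ?thesis using ne0 ne by (auto simp: G6_def G5_def G4_def G3_def)
  qed
  have new6: "(0, h, z) \<in> G6" "(0, p, g) \<in> G6" "(0, g, l) \<in> G6" "(0, l, h) \<in> G6"
    using ne ne0 new by (auto simp: G6_def G5_def G4_def G3_def)
  have ccw6: "ccw 0 h z" "ccw 0 g l" "ccw 0 l h"
    using h(4,5) g(5) crs_rotate[of 0 h z] crs_rotate[of 0 g l] by simp_all
  have star6: "successively (\<lambda>a b. (0, a, b) \<in> G6
    \<and> ccw 0 a b) (h # z # [w5, w6, x] @ [w8, p, g, l, h])"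
    using star2 keep6 M_out new6 ccw6 g(6) by auto
  have arcs6: "arcs G6 = arcs F - ({0} \<times> M \<union> M \<times> {0})
      \<union> ({l, s} \<times> {p, z} \<union> {p, z} \<times> {l, s})
      \<union> ({s} \<times> insert l M \<union> insert l M \<times> {s})
      \<union> ({0} \<times> {l, g, h} \<union> {l, g, h} \<times> {0})
      \<union> ({g, c} \<times> {p, l} \<union> {p, l} \<times> {g, c} \<union> {(g, c), (c, g)})
      \<union> ({h, d} \<times> {z, l} \<union> {z, l} \<times> {h, d} \<union> {(h, d), (d, h)})"
  proof -
    have "(l, y) \<notin> arcs F" "(y, l) \<notin> arcs F" for y
      using l(2) arcs_sym[of y l] by (auto simp: vertices_Domain)
    then have "arcs G1 - ({l} \<times> M \<union> M \<times> {l}) = arcs F - ({0} \<times> M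
      \<union> M \<times> {0}) \<union> ({l} \<times> {0, p, z} \<union> {0, p, z} \<times> {l})"
      unfolding G1(7) P using M_out M0 ne0 by auto
    then show ?thesis
      unfolding G6(2) G5(2) G4(2) G3(2) G2(2) P by auto
  qed
  show ?thesis
    unfolding z_def[symmetric] M_def[symmetric]
    by (rule exI[of _ G6], rule exI[of _ l], rule exI[of _ s], rule exI[of _ g], rule exI[of _ h],
        rule exI[of _ c], rule exI[of _ d])
      (use G6(1) new star6 arcs6 h g l(3) in \<open>auto simp: verts\<close>)
qed

text \<open>In \<open>insert_hub\<close> the old role of \<open>0\<close> towards \<open>q # butlast
  rs\<close> is taken over by the hub \<open>s\<close>, and the
  three special neighbours of \<open>0\<close> become \<open>h\<close>, \<open>x\<close> and
    \<open>g\<close>.\<close>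

lemma (in hub) step:
  "\<exists>G W' h g l. hub G A B C W' h (last rs) [w5, w6, x] w8 p g l u2 u3 u1
    \<and> card (vertices G) = card (vertices F) + 6
    \<and> card (arcs G \<inter> W' \<times> W') + 2 * card (vertices G - W')
      = card (arcs F \<inter> W \<times> W) + 2 * card (vertices F - W) + 26"
proof -
  define z where "z = last rs"
  define M where "M = set (q # butlast rs)"
  obtain G l s g h c d where G: "oriented_triangulation G A B C"
    and new: "distinct [l, s, g, h, c, d]" "{l, s, g, h, c, d} \<inter> vertices F = {}"
    and vG: "vertices G = vertices F \<union> {l, s, g, h, c, d}"
    and starG: "successively (\<lambda>a b. (0, a, b) \<in> G
      \<and> ccw 0 a b) (h # z # [w5, w6, x] @ [w8, p, g, l, h])"
    and u: "0 < u2 \<bullet> h" "0 < u3 \<bullet> g" "0 < u1 \<bullet> g" "0 < u1 \<bullet> l"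
      "0 < u1 \<bullet> h"
    and aG: "arcs G = arcs F - ({0} \<times> M \<union> M \<times> {0})
      \<union> ({l, s} \<times> {p, z} \<union> {p, z} \<times> {l, s})
      \<union> ({s} \<times> insert l M \<union> insert l M \<times> {s})
      \<union> ({0} \<times> {l, g, h} \<union> {l, g, h} \<times> {0})
      \<union> ({g, c} \<times> {p, l} \<union> {p, l} \<times> {g, c} \<union> {(g, c), (c, g)})
      \<union> ({h, d} \<times> {z, l} \<union> {z, l} \<times> {h, d} \<union> {(h, d), (d, h)})"
    using insert_hub unfolding z_def M_def by (elim exE conjE)
  define W' where "W' = W \<union> {l, g, h, c, d}"
  define R where "R = arcs F \<inter> W \<times> W"
  have fin: "finite (vertices F)" unfolding vertices_def using finite_F by simp
  have finW: "finite W" using W(1) fin finite_subset by blast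
  have arcs_vert: "a \<in> vertices F \<and> b \<in> vertices F" if "(a, b) \<in> arcs F" for a b
    using that arcs_sym[OF that] by (auto simp: vertices_Domain)
  have star_vert: "set (p # q # rs @ [w5, w6, x, w8, p]) \<subseteq> vertices F"
    by (rule star_vertices[OF star]) simp
  have zW: "z \<in> W" "z \<in> set rs" using W(4) rs by (simp_all add: z_def)
  have zero: "0 \<in> vertices F" using star vertices_F[of 0 p q] by auto
  have outW: "l \<notin> W" "s \<notin> W" "g \<notin> W" "h \<notin> W" "c \<notin> W" "d \<notin> W"
    and out0: "l \<noteq> 0" "s \<noteq> 0" "g \<noteq> 0" "h \<noteq> 0" "c \<noteq> 0" "d \<noteq> 0"
    using new(2) W(1) zero by auto
  have pz: "p \<noteq> z" using far(1) by (auto simp: z_def far4_def far3_def far2_def)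
  have "(0 :: complex) \<notin> W'" "s \<notin> W'" using outW out0 W(2) new(1) by (auto simp: W'_def)
  have dpz: "distinct [p, l, g, c]" "distinct [z, l, h, d]" using new(1) outW W(3) zW(1) by auto
  have K: "clique {p, l, g, c} = {(p, l), (p, g), (p, c), (l, p), (l, g), (l, c), (g, p), (g, l),
    (g, c), (c, p), (c, l), (c, g)}"
    "clique {z, l, h, d} = {(z, l), (z, h), (z, d), (l, z), (l, h), (l, d), (h, z), (h, l), (h, d),
      (d, z), (d, l), (d, h)}"
    by (rule clique_4[OF dpz(1)], rule clique_4[OF dpz(2)])
  have not_arc: "(y, v) \<notin> arcs F" "(v, y) \<notin> arcs F" if "y \<in> {l, s, g, h, c, d}" for y v
    using arcs_vert new(2) that by blast+
  \<comment> \<open>Arcs that were deleted end in \<open>0\<close>, and new arcs outside the two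
    copies end in \<open>0\<close> or \<open>s\<close>; neither vertex is in
    \<open>W'\<close>.\<close>
  have R': "arcs G \<inter> W' \<times> W' = R \<union> clique {p, l, g, c} \<union> clique {z, l, h, d}"
  proof (intro equalityI subrelI)
    fix a b assume ab: "(a, b) \<in> arcs G \<inter> W' \<times> W'"
    then have ne: "a \<noteq> 0" "b \<noteq> 0" "a \<noteq> s"
      "b \<noteq> s" using \<open>0 \<notin> W'\<close> \<open>s \<notin> W'\<close> by auto
    have old: "(a, b) \<in> R" if "(a, b) \<in> arcs F"
      using ab that not_arc[of a b] not_arc[of b a] by (auto simp: R_def W'_def)
    have "(a, b) \<in> arcs G" using ab by blast
    then show "(a, b) \<in> R \<union> clique {p, l, g, c} \<union> clique {z, l, h, d}"
      unfolding aG by (elim UnE DiffE) (use ne old in \<open>auto simp: K\<close>)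
  next
    have "clique {p, l, g, c} \<subseteq> arcs G" unfolding K
      by (intro insert_subsetI empty_subsetI; unfold aG; blast)
    moreover have "clique {z, l, h, d} \<subseteq> arcs G" unfolding K
      by (intro insert_subsetI empty_subsetI; unfold aG; blast)
    moreover have "clique {p, l, g, c} \<subseteq> W' \<times> W'"
      "clique {z, l, h, d} \<subseteq> W' \<times> W'"
    proof -
      have sub: "clique S \<subseteq> W' \<times> W'" if "S \<subseteq> W'" for S
        using that unfolding clique_def by blast
      show "clique {p, l, g, c} \<subseteq> W' \<times> W'" "clique {z, l, h, d} \<subseteq> W' \<times> W'"
        by (rule sub; use W(3) zW(1) in \<open>simp add: W'_def\<close>)+
    qed
    moreover have "R \<subseteq> arcs G"
    proof (rule subrelI)
      fix a b assume ab: "(a, b) \<in> R"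
      then have "a \<noteq> 0" "b \<noteq> 0" "(a, b) \<in> arcs F" using W(2) by (auto simp: R_def)
      then show "(a, b) \<in> arcs G" unfolding aG by blast
    qed
    moreover have "R \<subseteq> W' \<times> W'" unfolding R_def W'_def by blast
    ultimately have "R \<union> clique {p, l, g, c}
      \<union> clique {z, l, h, d} \<subseteq> arcs G \<inter> W' \<times> W'"
      by (intro Un_least Int_greatest)
    then show "(a, b) \<in> arcs G \<inter> W' \<times> W'"
      if "(a, b) \<in> R \<union> clique {p, l, g, c} \<union> clique {z, l, h, d}" for a b
      using that by (rule subsetD)
  qed
  have symR: "sym R" unfolding R_def sym_def using arcs_sym by blast
  have RWW: "R \<subseteq> W \<times> W" by (auto simp: R_def)
  have fars: "far2 R p x" "far2 R z x" "far3 R z x" "far4 R p z"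
    using far by (auto simp: R_def z_def far3_def)
  have dist5: "distinct [l, g, c, h, d]" "{l, g, c, h, d} \<inter> W = {}" using new(1) outW by auto
  note cl = two_cliques[OF RWW symR free[folded R_def] W(3) zW(1) dist5 fars(4), folded R']
  have symR': "sym (arcs G \<inter> W' \<times> W')"
  proof -
    interpret g: oriented_triangulation G A B C by fact
    show ?thesis unfolding sym_def using g.arcs_sym by blast
  qed
  \<comment> \<open>The three half-planes never change: their vectors are only permuted cyclically,
    because the open end turns around \<open>0\<close> by one sector.\<close>
  have "hub G A B C W' h z [w5, w6, x] w8 p g l u2 u3 u1"
  proof (intro hub.intro G hub_axioms.intro)
    show "successively (\<lambda>a b. (0, a, b) \<in> G
      \<and> ccw 0 a b) (h # z # [w5, w6, x] @ [w8, p, g, l, h])"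
      by (rule starG)
    have "z \<notin> {w5, w6, x, w8}" using dist zW(2) by auto
    then show "distinct (h # z # [w5, w6, x] @ [w8, p, g, l])"
      using dist new star_vert pz zW W(1) by auto
    show "W' \<subseteq> vertices G" using W(1) unfolding vG W'_def by auto
    show "0 < u2 \<bullet> a" if "a \<in> set (h # z # [w5, w6, x])" for a
      using that u2[of a] u by (auto simp: z_def)
    show "0 < u3 \<bullet> a" if "a \<in> {last [w5, w6, x], w8, p, g}" for a
      using that u3[of a] u by auto
    show "0 < u1 \<bullet> a" if "a \<in> {g, l, h}" for a
      using that u by auto
    show "c5_free (arcs G \<inter> W' \<times> W')" by (rule cl(1))
    show "far4 (arcs G \<inter> W' \<times> W') h (last [w5, w6, x])" using cl(4)[OF W(5) fars(1,3)] by simp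
    show "far2 (arcs G \<inter> W' \<times> W') h g" by (rule far2_sym[OF symR' cl(2)])
    show "far3 (arcs G \<inter> W' \<times> W') (last [w5, w6, x]) g"
      using far3_sym[OF symR' cl(3)[OF W(5) fars(1,2)]] by simp
    show "\<exists>w\<in>W'. (v, w) \<in> arcs G" if v: "v \<in> vertices G - W'" for v
    proof (cases "v = s \<or> v = 0")
      case True
      then show ?thesis using W(3) unfolding aG W'_def by blast
    next
      case False
      then have "v \<in> vertices F - W" using v by (auto simp: vG W'_def)
      then obtain w where w: "w \<in> W" "(v, w) \<in> arcs F" using nbr by blast
      then have "w \<noteq> 0" using W(2) by auto
      then have "(v, w) \<in> arcs G" using w False unfolding aG by blast
      then show ?thesis using w by (auto simp: W'_def)
    qed
  qed (use \<open>0 \<notin> W'\<close> W(5) in \<open>auto simp: W'_def\<close>)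
  moreover have "card (vertices G) = card (vertices F) + 6"
    using card_Un_disjoint[of "vertices F" "{l, s, g, h, c, d}"] fin new by (simp add: vG Int_commute)
  moreover have "card (vertices G - W') = card (vertices F - W) + 1"
  proof -
    have "vertices G - W' = insert s (vertices F - W)"
      using new outW unfolding vG W'_def by auto
    moreover have "s \<notin> vertices F" using new(2) by auto
    ultimately show ?thesis using fin by simp
  qed
  moreover have "card (arcs G \<inter> W' \<times> W') = card R + 24"
  proof -
    have "finite R" using finite_arcs by (simp add: R_def)
    \<comment> \<open>The copies share only \<open>l\<close>, so each contributes its twelve
      arcs.\<close>
    moreover have "card (clique {p, l, g, c} \<union> clique {z, l, h, d}) = 24"
    proof -
      have ne: "p \<noteq> z" "p \<noteq> l" "p \<noteq> g" "p \<noteq> h" "p \<noteq> c"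
        "p \<noteq> d" "z \<noteq> l" "z \<noteq> g" "z \<noteq> h" "z \<noteq> c" "z \<noteq> d"
        "l \<noteq> g" "l \<noteq> h" "l \<noteq> c" "l \<noteq> d" "g \<noteq> h" "g \<noteq> c"
        "g \<noteq> d" "h \<noteq> c" "h \<noteq> d" "c \<noteq> d"
        using new(1) pz outW W(3) zW(1) by auto
      show ?thesis unfolding K by (simp add: ne ne[symmetric])
    qed
    moreover have "R \<inter> (clique {p, l, g, c} \<union> clique {z, l, h, d}) = {}"
      using RWW outW unfolding K by auto
    moreover have "finite (clique {p, l, g, c} \<union> clique {z, l, h, d})"
      unfolding K by simp
    ultimately show ?thesis
      using card_Un_disjoint[of R "clique {p, l, g, c}
        \<union> clique {z, l, h, d}"] unfolding R' Un_assoc by simp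
  qed
  ultimately show ?thesis
    unfolding z_def[symmetric] R_def by (intro exI[of _ G] exI[of _ W'] exI[of _ h] exI[of _ g] exI[of _
      l]) simp
qed

text \<open>The new copy hangs at the cut vertex \<open>p\<close>, which a cycle passes only once. A
  cycle through a new vertex thus stays inside the copy, and four vertices are too few for length
  five.\<close>

lemma one_clique:
  assumes R: "R \<subseteq> D \<times> D" "sym R" "c5_free R"
    and new: "p \<in> D" "distinct [x, y, z]" "{x, y, z} \<inter> D = {}"
  defines "R' \<equiv> R \<union> clique {p, x, y, z}"
  shows "R' \<subseteq> (D \<union> {x, y, z}) \<times> (D \<union> {x, y, z})" "sym R'" "c5_free R'"
proof -
  show "R' \<subseteq> (D \<union> {x, y, z}) \<times> (D \<union> {x, y, z})"
  proof -
    have "clique {p, x, y, z} \<subseteq> {p, x, y, z} \<times> {p, x, y, z}" by (auto simp only: clique_def)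
    moreover have "{p, x, y, z} \<subseteq> D \<union> {x, y, z}" using new(1) by simp
    ultimately have "clique {p, x, y, z} \<subseteq> (D \<union> {x, y, z}) \<times> (D
      \<union> {x, y, z})" by blast
    then show ?thesis using R(1) unfolding R'_def by blast
  qed
  show sym': "sym R'"
    using R(2) unfolding R'_def sym_def clique_def by blast
  have ne: "x \<noteq> y" "x \<noteq> z" "y \<noteq> z" "x \<noteq> p" "y \<noteq> p"
    "z \<noteq> p" using new by auto
  have N: "v = p \<or> v = x \<or> v = y \<or> v = z" if "(u, v) \<in> R'"
    "u = x \<or> u = y \<or> u = z" for u v
    using that R(1) new(3) by (auto simp: R'_def clique_def)
  have no_new: False
    if "(a, b) \<in> R'" "(b, c) \<in> R'" "(c, d) \<in> R'" "(d, e) \<in> R'" "(e, a) \<in> R'"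
      "distinct [a, b, c, d, e]"
      and a: "a = x \<or> a = y \<or> a = z" for a b c d e
  proof -
    have b: "b = p \<or> b = x \<or> b = y \<or> b = z" using N[of a b] that by blast
    have e: "e = p \<or> e = x \<or> e = y \<or> e = z" using N[of a e] that sym' by (blast dest: symD)
    have c: "c = p \<or> c = x \<or> c = y \<or> c = z" if "b \<noteq> p" using N[of b c] b that
      \<open>(b, c) \<in> R'\<close> by blast
    have d: "d = p \<or> d = x \<or> d = y \<or> d = z" if "e \<noteq> p"
      using N[of e d] e that \<open>(d, e) \<in> R'\<close> sym' by (blast dest: symD)
    have cd: "d = p \<or> d = x \<or> d = y \<or> d = z" if "c \<noteq> p" "b \<noteq> p"
      using N[of c d] c that \<open>(c, d) \<in> R'\<close> by blast
    have dc: "c = p \<or> c = x \<or> c = y \<or> c = z" if "d \<noteq> p" "e \<noteq> p"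
      using N[of d c] d that \<open>(c, d) \<in> R'\<close> sym' by (blast dest: symD)
    show False using that(6) a b c d e cd dc by auto
  qed
  show "c5_free R'"
    unfolding c5_free_def
  proof (intro allI impI notI)
    fix v0 v1 v2 v3 v4
    assume E: "(v0, v1) \<in> R' \<and> (v1, v2) \<in> R' \<and> (v2, v3) \<in> R'
      \<and> (v3, v4) \<in> R' \<and> (v4, v0) \<in> R'"
      and dis: "distinct [v0, v1, v2, v3, v4]"
    have "v0 \<notin> {x, y, z}" "v1 \<notin> {x, y, z}" "v2 \<notin> {x, y, z}"
      "v3 \<notin> {x, y, z}" "v4 \<notin> {x, y, z}"
      using no_new[of v1 v2 v3 v4 v0] no_new[of v2 v3 v4 v0 v1] no_new[of v3 v4 v0 v1 v2]
        no_new[of v4 v0 v1 v2 v3] no_new[of v0 v1 v2 v3 v4] E dis by auto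
    then have "(v0, v1) \<in> R \<and> (v1, v2) \<in> R \<and> (v2, v3) \<in> R
      \<and> (v3, v4) \<in> R \<and> (v4, v0) \<in> R"
      using E dis by (auto simp: R'_def clique_def)
    then show False using R(3) dis unfolding c5_free_def by blast
  qed
qed

text \<open>A function that grows by at most one along every edge bounds distances from
  below.\<close>

lemma far_potential:
  fixes f :: "'a \<Rightarrow> nat"
  assumes "\<And>a b. (a, b) \<in> R \<Longrightarrow> f b \<le> f a + 1"
  shows "f a + 2 \<le> f b \<Longrightarrow> far2 R a b"
    and "f a + 3 \<le> f b \<Longrightarrow> far3 R a b"
    and "f a + 4 \<le> f b \<Longrightarrow> far4 R a b"
proof -
  have 2: "far2 R a b" if "f a + 2 \<le> f b" for a b
    using that assms[of a b] by (auto simp: far2_def)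
  then have 3: "far3 R a b" if "f a + 3 \<le> f b" for a b
    using that assms[of a] by (fastforce simp: far3_def)
  then have 4: "far4 R a b" if "f a + 4 \<le> f b" for a b
    using that assms[of a] by (fastforce simp: far4_def)
  show "f a + 2 \<le> f b \<Longrightarrow> far2 R a b"
    "f a + 3 \<le> f b \<Longrightarrow> far3 R a b" "f a + 4 \<le> f b \<Longrightarrow> far4 R a b"
    using 2 3 4 by blast+
qed

section \<open>Lists of insertions, for concrete triangulations\<close>

definition stack_face :: "('a \<times> 'a \<times> 'a) set \<Rightarrow> 'a \<times> 'a \<times> 'a
  \<Rightarrow> 'a \<Rightarrow> ('a \<times> 'a \<times> 'a) set" where
  "stack_face F = (\<lambda>(a, b, c) p. F - rotations (a, b, c) \<union> (rotations (a, b, p)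
    \<union> rotations (b, c, p) \<union> rotations (c, a, p)))"

definition spokes :: "'a \<times> 'a \<times> 'a \<Rightarrow> 'a \<Rightarrow> ('a \<times> 'a) set" where
  "spokes = (\<lambda>(a, b, c) p. {p} \<times> {a, b, c} \<union> {a, b, c} \<times> {p})"

fun stacks :: "('a \<times> 'a \<times> 'a) set \<Rightarrow> (('a \<times> 'a \<times> 'a) \<times> 'a)
  list \<Rightarrow> ('a \<times> 'a \<times> 'a) set" where
  "stacks F [] = F"
| "stacks F ((f, p) # xs) = stacks (stack_face F f p) xs"

text \<open>\<open>V\<close> carries the vertex set along, so freshness is checked without computing
  the vertices of each intermediate triangulation.\<close>

fun stackable :: "(complex \<times> complex \<times> complex) set \<Rightarrow> complex set
    \<Rightarrow> ((complex \<times> complex \<times> complex) \<times> complex) list \<Rightarrow>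
      bool" where
  "stackable F V [] \<longleftrightarrow> True"
| "stackable F V (((a, b, c), p) # xs) \<longleftrightarrow> (a, b, c) \<in> F \<and> ccw a b p
  \<and> ccw b c p \<and> ccw c a p \<and> p \<notin> V
    \<and> stackable (stack_face F (a, b, c) p) (insert p V) xs"

lemma stacks_triangulation:
  assumes "oriented_triangulation F A B C" "stackable F (vertices F) xs"
  shows "oriented_triangulation (stacks F xs) A B C"
    and "arcs (stacks F xs) = arcs F \<union> (\<Union>(f, p)\<in>set xs. spokes f p)"
    and "vertices (stacks F xs) = vertices F \<union> snd ` set xs"
proof -
  have "oriented_triangulation (stacks F xs) A B C \<and> arcs (stacks F xs) = arcs F
    \<union> (\<Union>(f, p)\<in>set xs. spokes f p)
    \<and> vertices (stacks F xs) = vertices F \<union> snd ` set xs"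
    using assms
  proof (induction xs arbitrary: F)
    case (Cons fp xs)
    obtain a b c p where fp: "fp = ((a, b, c), p)" by (metis prod_cases3 surj_pair)
    let ?G = "stack_face F (a, b, c) p"
    have *: "(a, b, c) \<in> F" "ccw a b p" "ccw b c p" "ccw c a p" "p \<notin> vertices F"
      using Cons.prems(2) by (simp_all add: fp)
    note G = oriented_triangulation.stack[OF Cons.prems(1) *]
    have "oriented_triangulation ?G A B C" and a: "arcs ?G = arcs F \<union> spokes (a, b, c) p"
      and v: "vertices ?G = insert p (vertices F)"
      using G by (simp_all only: stack_face_def spokes_def split)
    moreover have "stackable ?G (vertices ?G) xs"
      using Cons.prems(2) by (simp add: fp v)
    ultimately have "oriented_triangulation (stacks ?G xs) A B C"
      "arcs (stacks ?G xs) = arcs ?G \<union> (\<Union>(f, p)\<in>set xs. spokes f p)"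
      "vertices (stacks ?G xs) = vertices ?G \<union> snd ` set xs"
      using Cons.IH by blast+
    then show ?case by (auto simp: fp a v)
  qed auto
  then show "oriented_triangulation (stacks F xs) A B C"
    "arcs (stacks F xs) = arcs F \<union> (\<Union>(f, p)\<in>set xs. spokes f p)"
    "vertices (stacks F xs) = vertices F \<union> snd ` set xs" by blast+
qed

text \<open>The smallest case: one counterclockwise triangle, with its reverse as the outer
  face.\<close>

lemma single_triangle:
  assumes "ccw a b c"
  shows "oriented_triangulation (rotations (a, b, c) \<union> rotations (b, a, c)) b a c"
    and "arcs (rotations (a, b, c) \<union> rotations (b, a, c)) = {(a, b), (b, c), (c, a), (b, a),
      (a, c), (c, b)}"
    and "vertices (rotations (a, b, c) \<union> rotations (b, a, c)) = {a, b, c}"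
proof -
  have ne: "a \<noteq> b" "b \<noteq> c" "a \<noteq> c" using assms by auto
  show arcs: "arcs (rotations (a, b, c) \<union> rotations (b, a, c)) = {(a, b), (b, c), (c, a), (b, a),
    (a, c), (c, b)}"
    unfolding arcs_Un arcs_rotations by auto
  show "vertices (rotations (a, b, c) \<union> rotations (b, a, c)) = {a, b, c}"
    unfolding vertices_Domain arcs by auto
  show "oriented_triangulation (rotations (a, b, c) \<union> rotations (b, a, c)) b a c"
  proof
    fix x y z assume "(x, y, z) \<in> rotations (a, b, c) \<union> rotations (b, a, c)"
    then show "(x, y, z) \<in> rotations (b, a, c) \<or> ccw x y z"
      using rotations_crs[of x y z a b c] assms by auto
  next
    fix x y assume "(x, y) \<in> arcs (rotations (a, b, c) \<union> rotations (b, a, c))"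
    then show "(y, x) \<in> arcs (rotations (a, b, c) \<union> rotations (b, a, c))"
      unfolding arcs by auto
  qed (use assms ne in auto)
qed

section \<open>The initial triangulation\<close>

text \<open>The nested conditional lets the simplifier decide membership insertion by insertion,
  starting with the latest.\<close>

lemma mem_stack_face:
  "f \<in> stack_face F (a, b, c) p \<longleftrightarrow>
    (if f \<in> rotations (a, b, p) \<union> rotations (b, c, p) \<union> rotations (c, a, p) then True
     else if f \<in> rotations (a, b, c) then False else f \<in> F)"
  by (auto simp: stack_face_def)

text \<open>Seven copies of the complete graph on four vertices form a ring around \<open>0\<close>.
  Consecutive copies share
  one of \<open>e0\<close>, \dots, \<open>e6\<close>; the corners \<open>x\<close>, \<open>y\<close>,
    \<open>z\<close> point towards \<open>0\<close> and \<open>a\<close>, \<open>b\<close>,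
    \<open>c\<close>, \<open>d\<close>
  towards the vertex \<open>n\<close> outside the ring. The vertex in the middle of a copy is named
    after its corner.\<close>

lemma ex_hub_23:
  "\<exists>F A B C W p q rs w5 w6 x w8 u1 u2 u3. hub F A B C W p q rs w5 w6 x w8 u1 u2 u3
    \<and> card (vertices F) = 23
    \<and> card (arcs F \<inter> W \<times> W) + 2 * card (vertices F - W) = 88"
proof -
  \<comment> \<open>The points appear in the order of the abbreviations below, and the hub
    \<open>0\<close> is kept apart. Any distinct coordinates would serve that satisfy the
    orientation tests \<open>ccws\<close> and the half-plane conditions for the three vectors at the
    end.\<close>
  define pts where "pts = [Complex 90 (- 45),
    Complex 72 0, Complex 18 36, Complex (- 9) 27, Complex (- 27) 18, Complex (- 54) 0, Complex (- 90)
    (- 45), Complex 0 270, Complex 0 18, Complex (- 9) (- 27),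
    Complex 18 9, Complex (- 12) 105, Complex (- 27) 96, Complex (- 48) 75, Complex 54 75, Complex 3 27,
    Complex (- 3) (- 39), Complex 36 15, Complex (- 16) 50, Complex (- 36) 38, Complex (- 64) 10,
    Complex 72 10]"
  define pt where "pt = (\<lambda>i. pts ! i)"
  have "distinct (0 # pts)" by (simp add: pts_def complex_eq_iff)
  then have "distinct pts" "0 \<notin> set pts" by simp_all
  moreover have len: "length pts = 22" by (simp add: pts_def)
  ultimately have pt_eq: "i < 22 \<Longrightarrow> j < 22 \<Longrightarrow> pt i = pt j
    \<longleftrightarrow> i = j"
    and pt_0: "i < 22 \<Longrightarrow> pt i \<noteq> 0" "i < 22 \<Longrightarrow> 0 \<noteq> pt i" for i j
    using nth_eq_iff_index_eq[of pts i j] nth_mem[of i pts] unfolding pt_def by metis+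
  let ?e5 = "pt 0"
  let ?e6 = "pt 1"
  let ?e0 = "pt 2"
  let ?e1 = "pt 3"
  let ?e2 = "pt 4"
  let ?e3 = "pt 5"
  let ?e4 = "pt 6"
  let ?n = "pt 7"
  let ?y = "pt 8"
  let ?z = "pt 9"
  let ?x = "pt 10"
  let ?a = "pt 11"
  let ?b = "pt 12"
  let ?c = "pt 13"
  let ?d = "pt 14"
  let ?cY = "pt 15"
  let ?cZ = "pt 16"
  let ?cX = "pt 17"
  let ?ca = "pt 18"
  let ?cb = "pt 19"
  let ?cc = "pt 20"
  let ?cd = "pt 21"
  have ccws: "ccw ?e4 ?e5 ?n" "ccw ?n 0 ?e0" "ccw 0 ?n ?e1" "ccw ?e0 ?n ?e1" "ccw ?e1 0 ?e0"
    "ccw ?e4 ?e5 0" "ccw ?e5 ?n 0" "ccw ?n ?e4 0" "ccw ?e5 ?n ?e6" "ccw ?n 0 ?e6" "ccw 0 ?e5 ?e6"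
    "ccw 0 ?e6 ?e0" "ccw ?e6 ?n ?e0" "ccw ?n ?e4 ?e3" "ccw ?e4 0 ?e3" "ccw 0 ?n ?e3" "ccw 0 ?n ?e2"
    "ccw ?n ?e3 ?e2" "ccw ?e3 0 ?e2" "ccw ?n ?e2 ?e1" "ccw ?e2 0 ?e1" "ccw ?e0 ?e1 ?y" "ccw ?e1 0 ?y"
    "ccw 0 ?e0 ?y" "ccw ?e4 ?e5 ?z" "ccw ?e5 0 ?z" "ccw 0 ?e4 ?z" "ccw ?e6 ?e0 ?x" "ccw ?e0 0 ?x"
    "ccw 0 ?e6 ?x" "ccw ?e1 ?n ?a" "ccw ?n ?e2 ?a" "ccw ?e2 ?e1 ?a" "ccw ?e2 ?n ?b" "ccw ?n ?e3 ?b"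
    "ccw ?e3 ?e2 ?b" "ccw ?e3 ?n ?c" "ccw ?n ?e4 ?c" "ccw ?e4 ?e3 ?c" "ccw ?e5 ?n ?d" "ccw ?n ?e6 ?d"
    "ccw ?e6 ?e5 ?d" "ccw ?e0 ?e1 ?cY" "ccw ?e1 ?y ?cY" "ccw ?y ?e0 ?cY" "ccw ?e4 ?e5 ?cZ"
    "ccw ?e5 ?z ?cZ" "ccw ?z ?e4 ?cZ" "ccw ?e6 ?e0 ?cX" "ccw ?e0 ?x ?cX" "ccw ?x ?e6 ?cX"
    "ccw ?e2 ?e1 ?ca" "ccw ?e1 ?a ?ca" "ccw ?a ?e2 ?ca" "ccw ?e3 ?e2 ?cb" "ccw ?e2 ?b ?cb"
    "ccw ?b ?e3 ?cb" "ccw ?e4 ?e3 ?cc" "ccw ?e3 ?c ?cc" "ccw ?c ?e4 ?cc" "ccw ?e6 ?e5 ?cd"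
    "ccw ?e5 ?d ?cd" "ccw ?d ?e6 ?cd" "ccw 0 ?y ?e1" "ccw 0 ?e1 ?e2" "ccw 0 ?e2 ?e3" "ccw 0 ?e3 ?e4"
    "ccw 0 ?z ?e5" "ccw 0 ?x ?e0"
    by (simp_all add: pt_def pts_def crs_expand)
  note eqs = pt_eq pt_0 ccws[unfolded One_nat_def]
  define F0 where "F0 = rotations (?e4, ?e5, ?n) \<union> rotations (?e5, ?e4, ?n)"
  \<comment> \<open>Insertions into the triangle \<open>e4 e5 n\<close>. They surround
    \<open>0\<close> by \<open>e1\<close>, ..., \<open>e6\<close>, \<open>e0\<close> and
    \<open>n\<close>, so the ring is still open between \<open>e0\<close> and
    \<open>e1\<close>.\<close>
  define xs where "xs = [((?e4, ?e5, ?n), 0),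
      ((?e5, ?n, 0), ?e6),
      ((?n, 0, ?e6), ?e0),
      ((?n, ?e4, 0), ?e3),
      ((0, ?n, ?e3), ?e2),
      ((0, ?n, ?e2), ?e1)]"
  define ys where "ys = [((?e0, ?e1, 0), ?y),
      ((?e4, ?e5, 0), ?z),
      ((?e6, ?e0, 0), ?x),
      ((?e1, ?n, ?e2), ?a),
      ((?e2, ?n, ?e3), ?b),
      ((?e3, ?n, ?e4), ?c),
      ((?e5, ?n, ?e6), ?d),
      ((?e0, ?e1, ?y), ?cY),
      ((?e4, ?e5, ?z), ?cZ),
      ((?e6, ?e0, ?x), ?cX),
      ((?e2, ?e1, ?a), ?ca),
      ((?e3, ?e2, ?b), ?cb),
      ((?e4, ?e3, ?c), ?cc),
      ((?e6, ?e5, ?d), ?cd)]"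
  note F0 = single_triangle[OF ccws(1), folded F0_def]
  have "stackable F0 (vertices F0) xs"
    unfolding F0(3) xs_def by (simp add: F0_def mem_stack_face eqs)
  note F1 = stacks_triangulation[OF F0(1) this]
  define F1 where "F1 = stacks F0 xs"
  note F1 = F1[folded F1_def]
  have f1: "(?n, 0, ?e0) \<in> F1" "(0, ?n, ?e1) \<in> F1"
    by (simp_all add: F1_def xs_def F0_def mem_stack_face eqs)
  have "(?e0, ?e1) \<notin> arcs F1"
    unfolding F1(2) F0(2) by (simp add: xs_def spokes_def eqs)
  \<comment> \<open>Exchanging the diagonal from \<open>n\<close> to \<open>0\<close> for the one
    from \<open>e0\<close> to \<open>e1\<close> closes the ring and separates its two hubs.\<close>
  define F2 where "F2 = F1 - (rotations (?n, 0, ?e0) \<union> rotations (0, ?n, ?e1))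
    \<union> (rotations (?e0, ?n, ?e1) \<union> rotations (?e1, 0, ?e0))"
  note F2 = oriented_triangulation.flip[OF F1(1) f1 ccws(2,3,4,5) \<open>(?e0, ?e1) \<notin> arcs
    F1\<close>, folded F2_def]
  have mem_F2: "f \<in> F2 \<longleftrightarrow> (if f \<in> rotations (?e0, ?n, ?e1)
    \<union> rotations (?e1, 0, ?e0) then True
    else if f \<in> rotations (?n, 0, ?e0) \<union> rotations (0, ?n, ?e1) then False else f \<in> F1)" for f
    by (auto simp: F2_def)
  have "stackable F2 (vertices F2) ys"
    unfolding F2(3) F1(3) F0(3) ys_def
    by (simp add: mem_F2 F1_def F0_def xs_def mem_stack_face eqs)
  note F3 = stacks_triangulation[OF F2(1) this]
  define F where "F = stacks F2 ys"
  note F3 = F3[folded F_def]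
  have star: "successively (\<lambda>a b. (0, a, b) \<in> F
    \<and> ccw 0 a b) (?y # ?e1 # [?e2, ?e3, ?e4, ?z] @ [?e5, ?e6, ?x, ?e0, ?y])"
    by (simp add: F_def mem_F2 F1_def F0_def xs_def ys_def mem_stack_face eqs)
  \<comment> \<open>\<open>R5\<close> will be the open chain of five copies from \<open>e6\<close>
    to \<open>e1\<close>, each attached at the free joint of the previous one.\<close>
  define R1 where "R1 = {} \<union> clique {?e6, ?e5, ?d, ?cd}"
  define R2 where "R2 = R1 \<union> clique {?e5, ?e4, ?z, ?cZ}"
  define R3 where "R3 = R2 \<union> clique {?e4, ?e3, ?c, ?cc}"
  define R4 where "R4 = R3 \<union> clique {?e3, ?e2, ?b, ?cb}"
  define R5 where "R5 = R4 \<union> clique {?e2, ?e1, ?a, ?ca}"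
  have R0: "{} \<subseteq> {?e6} \<times> {?e6}" "sym {}" "c5_free {}" by (simp_all add: c5_free_def sym_def)
  define D1 where "D1 = {?e6} \<union> {?e5, ?d, ?cd}"
  have R1: "R1 \<subseteq> D1 \<times> D1" "sym R1" "c5_free R1"
    unfolding R1_def D1_def by (rule one_clique[OF R0]; simp add:  eqs)+
  define D2 where "D2 = D1 \<union> {?e4, ?z, ?cZ}"
  have R2: "R2 \<subseteq> D2 \<times> D2" "sym R2" "c5_free R2"
    unfolding R2_def D2_def by (rule one_clique[OF R1]; simp add: D1_def eqs)+
  define D3 where "D3 = D2 \<union> {?e3, ?c, ?cc}"
  have R3: "R3 \<subseteq> D3 \<times> D3" "sym R3" "c5_free R3"
    unfolding R3_def D3_def by (rule one_clique[OF R2]; simp add: D1_def D2_def eqs)+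
  define D4 where "D4 = D3 \<union> {?e2, ?b, ?cb}"
  have R4: "R4 \<subseteq> D4 \<times> D4" "sym R4" "c5_free R4"
    unfolding R4_def D4_def by (rule one_clique[OF R3]; simp add: D1_def D2_def D3_def eqs)+
  define D5 where "D5 = D4 \<union> {?e1, ?a, ?ca}"
  have R5: "R5 \<subseteq> D5 \<times> D5" "sym R5" "c5_free R5"
    unfolding R5_def D5_def by (rule one_clique[OF R4]; simp add: D1_def D2_def D3_def D4_def eqs)+
  define E where "E = R5 \<union> clique {?e6, ?e0, ?x, ?cX} \<union> clique {?e1, ?e0, ?y, ?cY}"
  \<comment> \<open>The position along the chain; only differences matter, and the default 9 is
    meant for \<open>e1\<close>, \<open>a\<close> and \<open>ca\<close>.\<close>
  define f where "f = (\<lambda>v. if v = ?e6 then 4 else if v \<in> {?e5, ?d, ?cd} then 5 else if v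
    \<in> {?e4, ?z, ?cZ} then 6
    else if v \<in> {?e3, ?c, ?cc} then 7 else if v \<in> {?e2, ?b, ?cb} then 8 else 9 :: nat)"
  have f: "f v \<le> f u + 1" if "(u, v) \<in> R5" for u v
  proof -
    have lev: "f v \<le> f u + 1" if "(u, v) \<in> clique S" "\<forall>w\<in>S. k \<le> f w
      \<and> f w \<le> k + 1" for S k
    proof -
      have "k \<le> f u" "f v \<le> k + 1" using that by (auto simp: clique_def)
      then show ?thesis by linarith
    qed
    show ?thesis
      using that unfolding R5_def R4_def R3_def R2_def R1_def
    proof (elim UnE emptyE)
      assume "(u, v) \<in> clique {?e6, ?e5, ?d, ?cd}"
      then show ?thesis by (rule lev[of _ 4]) (simp add: f_def eqs)
    next
      assume "(u, v) \<in> clique {?e5, ?e4, ?z, ?cZ}"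
      then show ?thesis by (rule lev[of _ 5]) (simp add: f_def eqs)
    next
      assume "(u, v) \<in> clique {?e4, ?e3, ?c, ?cc}"
      then show ?thesis by (rule lev[of _ 6]) (simp add: f_def eqs)
    next
      assume "(u, v) \<in> clique {?e3, ?e2, ?b, ?cb}"
      then show ?thesis by (rule lev[of _ 7]) (simp add: f_def eqs)
    next
      assume "(u, v) \<in> clique {?e2, ?e1, ?a, ?ca}"
      then show ?thesis by (rule lev[of _ 8]) (simp add: f_def eqs)
    qed
  qed
  have far: "far4 R5 ?e6 ?e1" "far2 R5 ?e6 ?z" "far3 R5 ?z ?e1"
    using far_potential[of R5 f, OF f] by (simp_all add: f_def eqs)
  have far': "far3 R5 ?e1 ?z" "far2 R5 ?e1 ?z"
    using far3_sym[OF R5(2) far(3)] by (simp_all add: far3_def)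
  have D5: "D5 = {?e6, ?e5, ?d, ?cd, ?e4, ?z, ?cZ, ?e3, ?c, ?cc, ?e2, ?b, ?cb, ?e1, ?a, ?ca}"
    by (simp add: D5_def D4_def D3_def D2_def D1_def insert_commute)
  have "?e6 \<in> D5" "?e1 \<in> D5" "?z \<in> D5" "distinct [?e0, ?x, ?cX, ?y, ?cY]"
    "{?e0, ?x, ?cX, ?y, ?cY} \<inter> D5 = {}"
    by (simp_all add: D5 eqs)
  \<comment> \<open>The last two copies meet in \<open>e0\<close> and close the ring just as in a
    prolongation, with \<open>e6\<close>, \<open>e1\<close>, \<open>e0\<close> as \<open>p\<close>,
    \<open>q\<close>, \<open>l\<close>. The distances between \<open>y\<close>, \<open>z\<close> and
    \<open>x\<close> come from the same lemma.\<close>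
  note ring = two_cliques[OF R5 this(1,2,4,5) far(1), folded E_def]
    and z_D5 = this(3)
  have symE: "sym E"
    using R5(2) unfolding E_def clique_def sym_def by blast
  define W where "W = insert ?e0 (insert ?x (insert ?cX (insert ?y (insert ?cY D5))))"
  have V: "vertices F = insert 0 (insert ?n W)"
    unfolding F3(3) F2(3) F1(3) F0(3) by (simp add: xs_def ys_def W_def D5 insert_commute)
  have W0: "0 \<notin> W" "?n \<notin> W" by (simp_all add: W_def D5 eqs)
  have cl: "clique {?e6, ?e5, ?d, ?cd} = {(?e6, ?e5), (?e6, ?d), (?e6, ?cd), (?e5, ?e6), (?e5, ?d),
    (?e5, ?cd), (?d, ?e6), (?d, ?e5), (?d, ?cd), (?cd, ?e6), (?cd, ?e5), (?cd, ?d)}"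
    "clique {?e5, ?e4, ?z, ?cZ} = {(?e5, ?e4), (?e5, ?z), (?e5, ?cZ), (?e4, ?e5), (?e4, ?z), (?e4, ?cZ),
    (?z, ?e5), (?z, ?e4), (?z, ?cZ), (?cZ, ?e5), (?cZ, ?e4), (?cZ, ?z)}"
    "clique {?e4, ?e3, ?c, ?cc} = {(?e4, ?e3), (?e4, ?c), (?e4, ?cc), (?e3, ?e4), (?e3, ?c), (?e3, ?cc),
    (?c, ?e4), (?c, ?e3), (?c, ?cc), (?cc, ?e4), (?cc, ?e3), (?cc, ?c)}"
    "clique {?e3, ?e2, ?b, ?cb} = {(?e3, ?e2), (?e3, ?b), (?e3, ?cb), (?e2, ?e3), (?e2, ?b), (?e2, ?cb),
    (?b, ?e3), (?b, ?e2), (?b, ?cb), (?cb, ?e3), (?cb, ?e2), (?cb, ?b)}"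
    "clique {?e2, ?e1, ?a, ?ca} = {(?e2, ?e1), (?e2, ?a), (?e2, ?ca), (?e1, ?e2), (?e1, ?a), (?e1, ?ca),
    (?a, ?e2), (?a, ?e1), (?a, ?ca), (?ca, ?e2), (?ca, ?e1), (?ca, ?a)}"
    "clique {?e6, ?e0, ?x, ?cX} = {(?e6, ?e0), (?e6, ?x), (?e6, ?cX), (?e0, ?e6), (?e0, ?x), (?e0, ?cX),
    (?x, ?e6), (?x, ?e0), (?x, ?cX), (?cX, ?e6), (?cX, ?e0), (?cX, ?x)}"
    "clique {?e1, ?e0, ?y, ?cY} = {(?e1, ?e0), (?e1, ?y), (?e1, ?cY), (?e0, ?e1), (?e0, ?y), (?e0, ?cY),
    (?y, ?e1), (?y, ?e0), (?y, ?cY), (?cY, ?e1), (?cY, ?e0), (?cY, ?y)}"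
    by (rule clique_4; simp add: eqs)+
  have arcs_F_eq: "arcs F = arcs F0 - {(?n, 0), (0, ?n)} \<union> {(?e0, ?e1), (?e1, ?e0)}
      \<union> ((\<Union>(f, p)\<in>set xs. spokes f p) - {(?n, 0), (0, ?n)})
        \<union> (\<Union>(f, p)\<in>set ys. spokes f p)"
    unfolding F3(2) F2(2) F1(2) by blast
  note spokes_iff = F0(2) xs_def ys_def list.set UN_insert UN_empty spokes_def split Un_iff mem_Sigma_iff
    insert_iff empty_iff Diff_iff prod.inject
  have arcs_F: "arcs F \<inter> W \<times> W = E"
  proof (intro equalityI subrelI IntI)
    fix u v assume uv: "(u, v) \<in> arcs F \<inter> W \<times> W"
    then have "u \<noteq> 0" "v \<noteq> 0" "u \<noteq> ?n" "v \<noteq> ?n" using W0 by auto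
    moreover have "(u, v) \<in> arcs F" using uv by blast
    ultimately show "(u, v) \<in> E"
      unfolding arcs_F_eq spokes_iff E_def R5_def R4_def R3_def R2_def R1_def cl
      by (elim disjE conjE) (simp_all add: eqs)
  next
    have "E \<subseteq> arcs F"
      unfolding arcs_F_eq E_def R5_def R4_def R3_def R2_def R1_def cl F0(2) xs_def ys_def
      by (simp add: spokes_def eqs)
    then show "(u, v) \<in> arcs F" if "(u, v) \<in> E" for u v using that by (rule subsetD)
    have "E \<subseteq> W \<times> W"
      unfolding E_def R5_def R4_def R3_def R2_def R1_def cl by (simp add: W_def D5)
    then show "(u, v) \<in> W \<times> W" if "(u, v) \<in> E" for u v using that by (rule subsetD)
  qed
  have hub: "hub F ?e5 ?e4 ?n W ?y ?e1 [?e2, ?e3, ?e4, ?z] ?e5 ?e6 ?x ?e0 (Complex (- 10) 1) (Complex 1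
    (- 1)) (Complex 1 1)"
  proof (intro hub.intro F3(1) hub_axioms.intro)
    show "successively (\<lambda>a b. (0, a, b) \<in> F \<and> ccw 0 a b)
        (?y # ?e1 # [?e2, ?e3, ?e4, ?z] @ [?e5, ?e6, ?x, ?e0, ?y])" by (rule star)
    show "c5_free (arcs F \<inter> W \<times> W)" unfolding arcs_F by (rule ring(1))
    show "far4 (arcs F \<inter> W \<times> W) ?y (last [?e2, ?e3, ?e4, ?z])"
      unfolding arcs_F using ring(4)[OF z_D5 far(2) far'(1)] by simp
    show "far2 (arcs F \<inter> W \<times> W) ?y ?x"
      unfolding arcs_F by (rule far2_sym[OF symE ring(2)])
    show "far3 (arcs F \<inter> W \<times> W) (last [?e2, ?e3, ?e4, ?z]) ?x"
      unfolding arcs_F using far3_sym[OF symE ring(3)[OF z_D5 far(2) far'(2)]] by simp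
    show "\<exists>w\<in>W. (v, w) \<in> arcs F" if "v \<in> vertices F - W" for v
    proof -
      have "(0, ?e3) \<in> arcs F" "(?n, ?e3) \<in> arcs F"
        unfolding F3(2) F2(2) F1(2) by (simp_all add: xs_def spokes_def eqs)
      moreover have "v = 0 \<or> v = ?n" using that unfolding V by blast
      ultimately have "(v, ?e3) \<in> arcs F" by (elim disjE) simp_all
      moreover have "?e3 \<in> W" by (simp add: W_def D5)
      ultimately show ?thesis by (rule bexI)
    qed
    show "0 < Complex (- 10) 1 \<bullet> v" if "v \<in> set (?y # ?e1 # [?e2, ?e3, ?e4, ?z])" for v
      using that by (auto simp: inner_complex_def pt_def pts_def)
    show "0 < Complex 1 (- 1) \<bullet> v" if "v \<in> {last [?e2, ?e3, ?e4, ?z], ?e5, ?e6, ?x}" for v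
      using that by (auto simp: inner_complex_def pt_def pts_def)
    show "0 < Complex 1 1 \<bullet> v" if "v \<in> {?x, ?e0, ?y}" for v
      using that by (auto simp: inner_complex_def pt_def pts_def)
  qed (use V W0 in \<open>auto simp: W_def D5 eqs\<close>)
  have card_V: "card (vertices F) = 23"
    unfolding V by (simp add: W_def D5 eqs)
  have "card (vertices F - W) = 2"
  proof -
    have "vertices F - W = {0, ?n}" using W0 unfolding V by blast
    then show ?thesis by (simp add: eqs)
  qed
  \<comment> \<open>Seven copies without common edges, twelve arcs each.\<close>
  moreover have "card (arcs F \<inter> W \<times> W) = 84"
    unfolding arcs_F E_def R5_def R4_def R3_def R2_def R1_def cl by (simp add: eqs)
  ultimately have "card (arcs F \<inter> W \<times> W) + 2 * card (vertices F - W) = 88" by simp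
  with hub card_V show ?thesis by blast
qed

section \<open>The lower bound\<close>

lemma ex_hub:
  "\<exists>F A B C W p q rs w5 w6 x w8 u1 u2 u3. hub F A B C W p q rs w5 w6 x w8 u1 u2 u3
    \<and> card (vertices F) = 23 + 6 * k
    \<and> card (arcs F \<inter> W \<times> W) + 2 * card (vertices F - W) = 88 + 26 * k"
proof (induction k)
  case 0
  then show ?case using ex_hub_23 by simp
next
  case (Suc k)
  then obtain F A B C W p q rs w5 w6 x w8 u1 u2 u3 where h: "hub F A B C W p q rs w5 w6 x w8 u1 u2 u3"
    "card (vertices F) = 23 + 6 * k" "card (arcs F \<inter> W \<times> W) + 2 * card (vertices F - W) =
      88 + 26 * k"
    by (elim exE conjE)
  obtain G W' h g l where "hub G A B C W' h (last rs) [w5, w6, x] w8 p g l u2 u3 u1"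
    "card (vertices G) = 23 + 6 * Suc k"
    "card (arcs G \<inter> W' \<times> W') + 2 * card (vertices G - W') = 88 + 26 * Suc k"
    using hub.step[OF h(1)] h(2,3) by auto
  then show ?case by blast
qed

text \<open>What remains of a hub once the tube is long enough: a face with a corner in
  \<open>W\<close>, ready for single vertices. \<open>cyc\<close> ensures that the triangulation
  contains a 5-cycle, as membership in the family requires.\<close>

locale rainbow_free = oriented_triangulation F A B C
  for F :: "(complex \<times> complex \<times> complex) set" and A B C +
  fixes W :: "complex set" and a b c :: complex
  assumes W: "W \<subseteq> vertices F" "a \<in> W"
    and face: "(a, b, c) \<in> F" "ccw a b c"
    and free: "c5_free (arcs F \<inter> W \<times> W)"
    and nbr: "\<And>v. v \<in> vertices F - W \<Longrightarrow> \<exists>w\<in>W. (v, w) \<in> arcs F"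
    and cyc: "\<not> c5_free (arcs F)"

lemma c5_free_mono: "c5_free S \<Longrightarrow> R \<subseteq> S \<Longrightarrow> c5_free R"
  unfolding c5_free_def by blast

lemma (in hub) rainbow_free: "rainbow_free F A B C W p q 0"
proof
  have pq: "(0, p, q) \<in> F" "ccw 0 p q" using star by auto
  show "(p, q, 0) \<in> F" "ccw p q 0"
    using rotate[OF pq(1)] pq(2) crs_rotate[of p q 0] by simp_all
  have rs_eq: "rs = butlast rs @ [last rs]" using rs by simp
  have "successively (\<lambda>a b. (0, a, b) \<in> F
    \<and> ccw 0 a b) ((p # q # butlast rs) @ [last rs, w5, w6, x, w8, p])"
    using star by (subst (asm) rs_eq) simp
  then have *: "(0, last rs, w5) \<in> F" "(0, w5, w6) \<in> F" "(0, w6, x) \<in> F"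
    unfolding successively_append_iff by auto
  \<comment> \<open>The hub and four consecutive neighbours form a 5-cycle.\<close>
  have "(0, last rs) \<in> arcs F" "(last rs, w5) \<in> arcs F" "(w5, w6) \<in> arcs F"
    "(w6, x) \<in> arcs F" "(x, 0) \<in> arcs F"
    using arcsI[OF *(1)] arcsI[OF *(2)] arcsI[OF *(3)] by auto
  moreover have "distinct [0, last rs, w5, w6, x]"
  proof -
    have "last rs \<in> set rs" using rs by simp
    then have "distinct [last rs, w5, w6, x]" using dist by auto
    moreover have "0 \<notin> {last rs, w5, w6, x}" using u2[of 0] by auto
    ultimately show ?thesis by simp
  qed
  ultimately show "\<not> c5_free (arcs F)" unfolding c5_free_def by blast
qed (use W free nbr in auto)

text \<open>The new vertex gets the neighbour \<open>a\<close> in \<open>W\<close>, and the new face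
  \<open>(a, b, d)\<close> keeps this corner, so the insertion can be repeated.\<close>

lemma (in rainbow_free) add_vertex:
  "\<exists>G d. rainbow_free G A B C W a b d \<and> card (vertices G) = card (vertices F) + 1
    \<and> arcs G \<inter> W \<times> W = arcs F \<inter> W \<times> W
      \<and> card (vertices G - W) = card (vertices F - W) + 1"
proof -
  obtain d where d: "d \<notin> vertices F" "ccw a b d" "ccw b c d" "ccw c a d"
    using stack_near[OF face(2), of UNIV] by auto
  define G where "G = F - rotations (a, b, c) \<union> (rotations (a, b, d)
    \<union> rotations (b, c, d) \<union> rotations (c, a, d))"
  note G = stack[OF face(1) d(2,3,4,1), folded G_def]
  have fin: "finite (vertices F)" unfolding vertices_def using finite_F by simp
  have dW: "d \<notin> W" using W d by auto
  have same: "arcs G \<inter> W \<times> W = arcs F \<inter> W \<times> W" unfolding G(2) using dW by auto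
  have "rainbow_free G A B C W a b d"
  proof (intro rainbow_free.intro G(1) rainbow_free_axioms.intro)
    show "W \<subseteq> vertices G" using W G(3) by auto
    show "(a, b, d) \<in> G" by (simp add: G_def)
    show "c5_free (arcs G \<inter> W \<times> W)" unfolding same by (rule free)
    show "\<not> c5_free (arcs G)" using cyc c5_free_mono[of "arcs G" "arcs F"] unfolding G(2) by blast
    show "\<exists>w\<in>W. (v, w) \<in> arcs G" if v: "v \<in> vertices G - W" for v
    proof (cases "v = d")
      case True
      then show ?thesis using W(2) unfolding G(2) by blast
    next
      case False
      then have "v \<in> vertices F - W" using v G(3) by auto
      then show ?thesis using nbr unfolding G(2) by blast
    qed
  qed (use W d in auto)
  moreover have "vertices G - W = insert d (vertices F - W)" using dW G(3) by auto
  ultimately show ?thesis using same d(1) fin G(3) by auto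
qed

lemma ex_rainbow_free:
  "\<exists>F A B C W a b c. rainbow_free F A B C W a b c \<and> card (vertices F) = 23 + 6 * k + r
    \<and> card (arcs F \<inter> W \<times> W) + 2 * card (vertices F - W) = 88 + 26 * k + 2 * r"
proof (induction r)
  case 0
  obtain F A B C W p q rs w5 w6 x w8 u1 u2 u3 where h: "hub F A B C W p q rs w5 w6 x w8 u1 u2 u3"
    "card (vertices F) = 23 + 6 * k" "card (arcs F \<inter> W \<times> W) + 2 * card (vertices F - W) =
      88 + 26 * k"
    using ex_hub[of k] by (elim exE conjE)
  show ?case using hub.rainbow_free[OF h(1)] h(2,3) unfolding add_0_right mult_0_right by blast
next
  case (Suc r)
  then obtain F A B C W a b c where f: "rainbow_free F A B C W a b c" "card (vertices F) = 23 + 6 * k + r"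
    "card (arcs F \<inter> W \<times> W) + 2 * card (vertices F - W) = 88 + 26 * k + 2 * r"
    by (elim exE conjE)
  obtain G d where "rainbow_free G A B C W a b d" "card (vertices G) = 23 + 6 * k + Suc r"
    "card (arcs G \<inter> W \<times> W) + 2 * card (vertices G - W) = 88 + 26 * k + 2 * Suc r"
    using rainbow_free.add_vertex[OF f(1)] f(2,3) by auto
  then show ?case by blast
qed

theorem theorem3p1:
  fixes n r :: nat
  assumes "n \<ge> 119" and "r = (n + 7) mod 18"
  shows "real (planar_anti_ramsey n (cycle_graph 5)) \<ge> (39 * real n - 123 - 21 * real r) / 18"
proof -
  define k where "k = (n + 7) div 18"
  have n: "n + 7 = 18 * k + r" unfolding k_def assms(2) by simp
  have "r < 18" using assms(2) by simp
  then have k: "k \<ge> 6" using n assms(1) by linarith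
  \<comment> \<open>\<open>23 + 6 * (3 * k - 5) = 18 * k - 7\<close>; the subtraction is exact
    because \<open>k\<close> is at least 6.\<close>
  obtain F A B C W a b c where f: "rainbow_free F A B C W a b c"
    "card (vertices F) = 23 + 6 * (3 * k - 5) + r"
    "card (arcs F \<inter> W \<times> W) + 2 * card (vertices F - W) = 88 + 26 * (3 * k - 5) + 2 * r"
    using ex_rainbow_free[of "3 * k - 5" r] by (elim exE conjE)
  interpret rainbow_free F A B C W a b c by (rule f(1))
  have "card (vertices F) = n" using f(2) n k by linarith
  then have "88 + 26 * (3 * k - 5) + 2 * r \<le> 2 * planar_anti_ramsey n (cycle_graph 5)"
    using planar_anti_ramsey_cycle_5_ge[OF oriented_triangulation_axioms W(1) free nbr cyc] f(3) by simp
  then have "39 * k + r \<le> planar_anti_ramsey n (cycle_graph 5) + 21" using k by linarith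
  \<comment> \<open>In terms of \<open>k\<close> and \<open>r\<close> the claimed bound is
    \<open>39 * k + r - 22\<close>, one less than the number of colours obtained.\<close>
  moreover have "real n + 7 = 18 * real k + real r" using n by (metis of_nat_add of_nat_mult of_nat_numeral)
  ultimately show ?thesis by (simp add: field_simps)
qed

end
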